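(* Let $G$ be a finitely generated discrete group with a finite symmetric generating set $S$, and let $P$ be the step distribution of the lazy simple random walk on the Cayley graph of $(G,S)$. Assume that there are $K,L>0$ and $\nu\in(0,1]$ such that $|B_n|\le Le^{Kn^{\nu}}$ for all $n\geq 1$. Then: (a) There are constants $K',K'',L''>0$ such that for all $n\ge1$, $\mathbb E|P^{(n)}|\le K'n^{1/(2-\nu)}$ (hence $\beta\le 1/(2-\nu)$) and $H(P^{(n)})\le L''+K''n^{\nu/(2-\nu)}$. (b) $\alpha(G)\ge 1-\nu$. (c) If there are $K',L'>0$ and a real number $h$ such that $H(P^{(n)})\ge K'+L'n^{h}$ for all $n\ge1$, then $\beta\nu\ge h$ and $2h\,\alpha(G)\le\nu$.
   Context: For a finite symmetric generating set $S$ of $G$, $P=\tfrac12(\delta_e+P')$ where $P'=\mathbf 1_S/|S|$ is the uniform distribution on $S$; $P^{(n)}$ is the $n$-fold convolution of $P$ with itself. $|g|$ denotes the word length of $g$ with respect to $S$, and $B_n=\{g\in G: |g|\le n\}$. Speed: $\mathbb E|P^{(n)}|=\sum_{g\in G}|g|P^{(n)}(g)$. Speed exponent: $\beta=\sup\{c\in[0,1]: \exists K>0 \text{ such that } \mathbb E|P^{(n)}|\ge Kn^c \text{ for all } n\ge1\}$. Entropy: $H(P^{(n)})=-\sum_{g\in G}P^{(n)}(g)\ln P^{(n)}(g)$. Compression exponent: let $B$ be a Hilbert space and $\pi:G\to\mathrm{Isom}(B)$ a homomorphism to the group of (affine) isometries of $B$. An equivariant uniform embedding is a map $f:G\to B$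 with $f(\gamma x)=\pi(\gamma)f(x)$ for all $\gamma,x\in G$, for which there exist an unbounded increasing (non-decreasing) function $\rho_-:\mathbb R_{\ge0}\to\mathbb R_{\ge0}$ and a constant $C>0$ with $$\rho_-(|y^{-1}x|)\le\|f(x)-f(y)\|\le C|y^{-1}x|+C\qquad\text{for all }x,y\in G.$$ Such a $\rho_-$ is called a compression function of $f$. The compression exponent $\alpha(f)$ is the supremum of the $c\in[0,1]$ for which there exist $K>0$ and a compression function $\rho_-$ of $f$ with $\rho_-(n)\ge Kn^c$ for all integers $n\ge1$. The equivariant compression exponent $\alpha(G)$ is the supremum of $\alpha(f)$ over all Hilbert spaces $B$, all $\pi$ and all equivariant uniform embeddings $f$ (with $\alpha(G)=0$ if there are none). *)

theory Defs
  imports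
    "HOL-Probability.Probability"
    "HOL-Algebra.Bij"
    "HOL-Algebra.Module"
    "HOL-Algebra.Generated_Groups"
begin

section \<open>Word length and the lazy simple random walk\<close>

definition symmetric_generating_set :: "('a, 'm) monoid_scheme \<Rightarrow> 'a set \<Rightarrow> bool" where
  "symmetric_generating_set G S \<longleftrightarrow>
     finite S \<and> S \<noteq> {} \<and> S \<subseteq> carrier G \<and> (\<forall>s\<in>S. inv\<^bsub>G\<^esub> s \<in> S) \<and> generate G S = carrier G"

definition word_length :: "('a, 'm) monoid_scheme \<Rightarrow> 'a set \<Rightarrow> 'a \<Rightarrow> nat" where
  "word_length G S g =
     (LEAST n. \<exists>w. set w \<subseteq> S \<and> length w = n \<and> foldr (\<lambda>x y. x \<otimes>\<^bsub>G\<^esub> y) w \<one>\<^bsub>G\<^esub> = g)"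

definition word_ball :: "('a, 'm) monoid_scheme \<Rightarrow> 'a set \<Rightarrow> nat \<Rightarrow> 'a set" where
  "word_ball G S n = {g \<in> carrier G. word_length G S g \<le> n}"

definition lazy_step :: "('a, 'm) monoid_scheme \<Rightarrow> 'a set \<Rightarrow> 'a pmf" where
  "lazy_step G S =
     bind_pmf (bernoulli_pmf (1 / 2)) (\<lambda>b. if b then return_pmf \<one>\<^bsub>G\<^esub> else pmf_of_set S)"

lemma pmf_lazy_step:
  assumes "finite S" "S \<noteq> {}"
  shows "pmf (lazy_step G S) g = 1 / 2 * (indicator {\<one>\<^bsub>G\<^esub>} g + indicator S g / real (card S))"
  using assms by (simp add: lazy_step_def pmf_bind field_simps indicator_def)

definition convolution :: "('a, 'm) monoid_scheme \<Rightarrow> 'a pmf \<Rightarrow> 'a pmf \<Rightarrow> 'a pmf" where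
  "convolution G p q = map_pmf (\<lambda>(x, y). x \<otimes>\<^bsub>G\<^esub> y) (pair_pmf p q)"

primrec convolution_power :: "('a, 'm) monoid_scheme \<Rightarrow> 'a pmf \<Rightarrow> nat \<Rightarrow> 'a pmf" where
  "convolution_power G p 0 = return_pmf \<one>\<^bsub>G\<^esub>"
| "convolution_power G p (Suc n) = convolution G (convolution_power G p n) p"

definition speed :: "('a, 'm) monoid_scheme \<Rightarrow> 'a set \<Rightarrow> nat \<Rightarrow> real" where
  "speed G S n =
     (\<Sum>\<^sub>\<infinity>g\<in>carrier G. real (word_length G S g) * pmf (convolution_power G (lazy_step G S) n) g)"

definition walk_entropy :: "('a, 'm) monoid_scheme \<Rightarrow> 'a set \<Rightarrow> nat \<Rightarrow> real" where
  "walk_entropy G S n =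
     - (\<Sum>\<^sub>\<infinity>g\<in>carrier G. pmf (convolution_power G (lazy_step G S) n) g *
                            ln (pmf (convolution_power G (lazy_step G S) n) g))"

text \<open>All exponents below are suprema of subsets of \<open>[0, 1]\<close>, where the supremum of the empty
  set is \<open>0\<close>; on type \<^typ>\<open>real\<close>, \<open>Sup {}\<close> is unspecified.\<close>

definition sup_unit :: "real set \<Rightarrow> real" where
  "sup_unit X = (if X = {} then 0 else Sup X)"

definition speed_exponent :: "('a, 'm) monoid_scheme \<Rightarrow> 'a set \<Rightarrow> real" where
  "speed_exponent G S =
     sup_unit {c \<in> {0..1}. \<exists>K>0. \<forall>n\<ge>1. speed G S n \<ge> K * real n powr c}"

section \<open>Hilbert spaces as objects and their affine isometries\<close>

text \<open>The compression exponent is a supremum over all Hilbert spaces, so they are represented by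
  structures with an explicit carrier set rather than by the type classes of HOL-Analysis.\<close>

definition real_ring :: "real ring" where
  "real_ring = \<lparr>carrier = UNIV, monoid.mult = (*), one = 1, zero = 0, add = (+)\<rparr>"

record 'b inner_space = "(real, 'b) module" +
  inner_prod :: "'b \<Rightarrow> 'b \<Rightarrow> real"

definition hnorm :: "('b, 'm) inner_space_scheme \<Rightarrow> 'b \<Rightarrow> real" where
  "hnorm B x = sqrt (inner_prod B x x)"

definition hdist :: "('b, 'm) inner_space_scheme \<Rightarrow> 'b \<Rightarrow> 'b \<Rightarrow> real" where
  "hdist B x y = hnorm B (x \<ominus>\<^bsub>B\<^esub> y)"

locale hilbert_space = Module.module real_ring B for B :: "('b, 'm) inner_space_scheme" (structure) +
  assumes inner_prod_commute:
      "\<lbrakk>x \<in> carrier B; y \<in> carrier B\<rbrakk> \<Longrightarrow> inner_prod B x y = inner_prod B y x"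
    and inner_prod_add_left:
      "\<lbrakk>x \<in> carrier B; y \<in> carrier B; z \<in> carrier B\<rbrakk> \<Longrightarrow>
         inner_prod B (x \<oplus> y) z = inner_prod B x z + inner_prod B y z"
    and inner_prod_smult_left:
      "\<lbrakk>x \<in> carrier B; y \<in> carrier B\<rbrakk> \<Longrightarrow>
         inner_prod B (t \<odot>\<^bsub>B\<^esub> x) y = t * inner_prod B x y"
    and inner_prod_nonneg: "x \<in> carrier B \<Longrightarrow> 0 \<le> inner_prod B x x"
    and inner_prod_eq_0: "\<lbrakk>x \<in> carrier B; inner_prod B x x = 0\<rbrakk> \<Longrightarrow> x = \<zero>"
    and complete: "Metric_space.mcomplete (carrier B) (hdist B)"

definition affine_isometries :: "('b, 'm) inner_space_scheme \<Rightarrow> ('b \<Rightarrow> 'b) set" where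
  "affine_isometries B =
     {T \<in> Bij (carrier B).
        (\<forall>x\<in>carrier B. \<forall>y\<in>carrier B. hdist B (T x) (T y) = hdist B x y) \<and>
        (\<forall>x\<in>carrier B. \<forall>y\<in>carrier B. \<forall>t::real.
           T ((1 - t) \<odot>\<^bsub>B\<^esub> x \<oplus>\<^bsub>B\<^esub> t \<odot>\<^bsub>B\<^esub> y) = (1 - t) \<odot>\<^bsub>B\<^esub> T x \<oplus>\<^bsub>B\<^esub> t \<odot>\<^bsub>B\<^esub> T y)}"

definition isometry_group :: "('b, 'm) inner_space_scheme \<Rightarrow> ('b \<Rightarrow> 'b) monoid" where
  "isometry_group B = (BijGroup (carrier B)) \<lparr>carrier := affine_isometries B\<rparr>"

section \<open>Equivariant Hilbert space compression\<close>

definition compression_function ::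
  "('a, 'm) monoid_scheme \<Rightarrow> 'a set \<Rightarrow> ('b, 'k) inner_space_scheme \<Rightarrow> ('a \<Rightarrow> 'b) \<Rightarrow> (real \<Rightarrow> real) \<Rightarrow> bool"
where
  "compression_function G S B f \<rho> \<longleftrightarrow>
     (\<forall>t\<ge>0. 0 \<le> \<rho> t) \<and> mono_on {0..} \<rho> \<and> \<not> bdd_above (\<rho> ` {0..}) \<and>
     (\<forall>x\<in>carrier G. \<forall>y\<in>carrier G.
        \<rho> (real (word_length G S (inv\<^bsub>G\<^esub> y \<otimes>\<^bsub>G\<^esub> x))) \<le> hdist B (f x) (f y))"

definition equivariant_uniform_embedding ::
  "('a, 'm) monoid_scheme \<Rightarrow> 'a set \<Rightarrow> ('b, 'k) inner_space_scheme \<Rightarrow> ('a \<Rightarrow> 'b \<Rightarrow> 'b) \<Rightarrow> ('a \<Rightarrow> 'b) \<Rightarrow> bool"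
where
  "equivariant_uniform_embedding G S B \<pi> f \<longleftrightarrow>
     f \<in> carrier G \<rightarrow> carrier B \<and>
     (\<forall>\<gamma>\<in>carrier G. \<forall>x\<in>carrier G. f (\<gamma> \<otimes>\<^bsub>G\<^esub> x) = \<pi> \<gamma> (f x)) \<and>
     (\<exists>\<rho>. compression_function G S B f \<rho>) \<and>
     (\<exists>C>0. \<forall>x\<in>carrier G. \<forall>y\<in>carrier G.
        hdist B (f x) (f y) \<le> C * real (word_length G S (inv\<^bsub>G\<^esub> y \<otimes>\<^bsub>G\<^esub> x)) + C)"

definition compression_exponent ::
  "('a, 'm) monoid_scheme \<Rightarrow> 'a set \<Rightarrow> ('b, 'k) inner_space_scheme \<Rightarrow> ('a \<Rightarrow> 'b) \<Rightarrow> real"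
where
  "compression_exponent G S B f =
     sup_unit {c \<in> {0..1}. \<exists>K>0. \<exists>\<rho>. compression_function G S B f \<rho> \<and>
                             (\<forall>n::nat. n \<ge> 1 \<longrightarrow> \<rho> (real n) \<ge> K * real n powr c)}"

text \<open>A definition in HOL cannot quantify over types, so the Hilbert spaces range over those whose
  carrier is a set of elements of the type \<^typ>\<open>(nat \<Rightarrow> real) \<times> 'u\<close>, for a type parameter \<open>'u\<close>.
  The first factor ensures that, whatever \<open>'u\<close> is, there are enough elements for an isomorphic copy
  of every separable Hilbert space, which covers the closed affine hull of an orbit of a countable
  group. The second factor ensures that every Hilbert space whose elements form a type occurs for a
  suitable \<open>'u\<close>.\<close>

definition equivariant_compression_exponent ::
  "'u itself \<Rightarrow> ('a, 'm) monoid_scheme \<Rightarrow> 'a set \<Rightarrow> real"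
where
  "equivariant_compression_exponent U G S =
     sup_unit {compression_exponent G S B f |
                 (B :: ((nat \<Rightarrow> real) \<times> 'u) inner_space) \<pi> f.
                 hilbert_space B \<and> \<pi> \<in> hom G (isometry_group B) \<and>
                 equivariant_uniform_embedding G S B \<pi> f}"

end

theory Submission
  imports Defs "HOL-Real_Asymp.Real_Asymp"
begin

text \<open>
  Write \<open>X n\<close> for the position of the lazy walk after \<open>n\<close> steps, \<open>\<bar>x\<bar>\<close> for word length, \<open>L n\<close> for the
  mean of \<open>\<bar>X n\<bar>\<close> and \<open>H n\<close> for the entropy of \<open>X n\<close>.

  Growth bounds entropy by moments. The weight \<open>exp (- 2 K \<bar>x\<bar>\<^sup>\<nu>)\<close> has finite total mass, because the
  sphere of radius \<open>r\<close> has at most \<open>L exp (K r\<^sup>\<nu>)\<close> elements. Comparing the law of \<open>X n\<close> with this weight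
  by Gibbs' inequality gives \<open>H n \<le> C + 2 K E \<bar>X n\<bar>\<^sup>\<nu>\<close> (\<open>entropy_le_moment\<close>), hence
  \<open>H n \<le> C + 4 K (L n)\<^sup>\<nu>\<close> (\<open>entropy_le_speed\<close>).

  Entropy bounds speed. The increment \<open>H (n + 1) - H n\<close> is the average, over one step \<open>s\<close>, of the entropy
  of the law of \<open>X n \<cdot> s\<close> relative to the law of \<open>X (n + 1)\<close>, and so it dominates a squared total
  variation distance. Word length changes by at most \<open>1\<close> under a step, so the same total variation
  distance controls \<open>L (n + 1) - L n\<close>. Summing over time gives \<open>(L n)\<^sup>2 \<le> 9 n H n\<close>
  (\<open>speed_increment_le\<close>, \<open>speed_squared_le\<close>). Inserting the bound on \<open>H n\<close> leaves
  \<open>(L n)\<^bsup>2 - \<nu>\<^esup> = O(n)\<close>, which is part (a). Read in the other direction, \<open>entropy_le_speed\<close> turns a lower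
  bound on the entropy into one on the speed, which is the first half of part (c).

  Hilbert compression limits the walk. If \<open>f\<close> is equivariant with values in a Hilbert space, then
  \<open>\<parallel>f x - f y\<parallel>\<^sup>2\<close> is a kernel of conditionally negative type. Applied to the difference of the laws of
  \<open>X m\<close> and \<open>X (m + 2)\<close> this says that \<open>E \<parallel>f (X (2 m)) - f e\<parallel>\<^sup>2\<close> is a concave function of \<open>m\<close>, so it grows
  at most linearly (\<open>mean_displacement_linear\<close>). A compression function above \<open>A n\<^sup>c\<close> thus gives
  \<open>E \<bar>X (2 m)\<bar>\<^bsup>2 c\<^esup> = O(m)\<close>, and \<open>entropy_le_moment\<close> converts this into the second half of part (c).

  Growth produces an embedding. For each scale \<open>2\<^sup>j\<close> take the function \<open>exp (- \<eta> j \<bar>x\<bar>)\<close> on the group with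
  decay rate \<open>\<eta> j\<close> proportional to \<open>2\<^bsup>j (\<nu> - 1)\<^esup>\<close>, normalised in square norm. A decay of this
  order is enough for the growth bound to confine three quarters of the mass to radius \<open>2\<^sup>j / 2\<close>, so translating by an
  element of length at least \<open>2\<^sup>j\<close> moves the function by a constant, while a translation of length \<open>l\<close> moves
  it by at most \<open>2 \<eta> j l\<close>. Weighting scale \<open>j\<close> by \<open>2\<^bsup>j c\<^esup>\<close> with \<open>c < 1 - \<nu>\<close> makes the displacements square
  summable and at least of order \<open>\<bar>x\<bar>\<^sup>c\<close>. The direct sum over the scales is realised on square summable
  sequences by enumerating \<open>\<nat> \<times> G\<close>, and the coboundary of the weighted family is the embedding for part (b).
\<close>

section \<open>Elementary estimates\<close>

lemma powr_exponent_le: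
  fixes A B a b :: real
  assumes "A > 0" and le: "\<forall>n\<ge>1. A * real n powr a \<le> B * real n powr b"
  shows "a \<le> b"
proof (rule ccontr)
  assume "\<not> a \<le> b"
  then have "filterlim (\<lambda>n. real n powr (a - b)) at_top sequentially" by real_asymp
  then have "eventually (\<lambda>n. real n powr (a - b) > B / A) sequentially"
    by (auto simp: filterlim_at_top_dense)
  then obtain N where N: "\<And>n. n \<ge> N \<Longrightarrow> real n powr (a - b) > B / A"
    by (auto simp: eventually_sequentially)
  define n where "n = max N 1"
  have "A * real n powr (a - b) > B" using N[of n] assms(1) by (auto simp: n_def field_simps)
  then have "A * real n powr (a - b) * real n powr b > B * real n powr b"
    by (rule mult_strict_right_mono) (auto simp: n_def)
  also have "A * real n powr (a - b) * real n powr b = A * real n powr a"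
    by (simp add: powr_add[symmetric] mult.assoc)
  finally show False using le by (auto simp: n_def not_le[symmetric])
qed

text \<open>
  Jensen's inequality for a concave power, up to a factor \<open>2\<close>. If \<open>m\<close> is the mean of \<open>Y\<close>, then
  \<open>Y x powr \<theta> \<le> m powr \<theta> * (1 + Y x / m)\<close>: below \<open>m\<close> the power is monotone, and above \<open>m\<close> the exponent
  \<open>\<theta>\<close> may be raised to \<open>1\<close> after division by \<open>m\<close>.
\<close>
lemma mean_powr_le:
  fixes q Y :: "'x \<Rightarrow> real"
  assumes "finite A" and q: "\<And>x. x \<in> A \<Longrightarrow> 0 \<le> q x" and "(\<Sum>x\<in>A. q x) = 1"
    and Y: "\<And>x. x \<in> A \<Longrightarrow> 0 \<le> Y x" and "0 < \<theta>" "\<theta> \<le> 1"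
  shows "(\<Sum>x\<in>A. q x * Y x powr \<theta>) \<le> 2 * (\<Sum>x\<in>A. q x * Y x) powr \<theta>"
proof -
  define m where "m = (\<Sum>x\<in>A. q x * Y x)"
  have "m \<ge> 0" unfolding m_def by (intro sum_nonneg mult_nonneg_nonneg q Y)
  show ?thesis
  proof (cases "m = 0")
    case True
    then have "\<forall>x\<in>A. q x * Y x = 0"
      using sum_nonneg_eq_0_iff[of A "\<lambda>x. q x * Y x"] assms by (auto simp: m_def)
    then have "(\<Sum>x\<in>A. q x * Y x powr \<theta>) = 0" by (intro sum.neutral) auto
    then show ?thesis by simp
  next
    case False
    then have "m > 0" using \<open>m \<ge> 0\<close> by simp
    have pointwise: "Y x powr \<theta> \<le> m powr \<theta> * (1 + Y x / m)" if "x \<in> A" for x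
    proof (cases "Y x \<le> m")
      case True
      then have "Y x powr \<theta> \<le> m powr \<theta>" using assms that by (intro powr_mono2) auto
      also have "\<dots> \<le> m powr \<theta> * (1 + Y x / m)"
        using \<open>m > 0\<close> Y[OF that] by (simp add: ring_distribs)
      finally show ?thesis .
    next
      case False
      have "Y x powr \<theta> = m powr \<theta> * (Y x / m) powr \<theta>"
        using \<open>m > 0\<close> Y[OF that] by (simp add: powr_divide)
      also have "(Y x / m) powr \<theta> \<le> (Y x / m) powr 1"
        using False \<open>m > 0\<close> assms by (intro powr_mono) auto
      also have "(Y x / m) powr 1 \<le> 1 + Y x / m" using Y[OF that] \<open>m > 0\<close> by simp
      finally show ?thesis by (simp add: mult_left_mono)
    qed
    have "(\<Sum>x\<in>A. q x * Y x powr \<theta>) \<le> (\<Sum>x\<in>A. q x * (m powr \<theta> * (1 + Y x / m)))"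
      by (intro sum_mono mult_left_mono pointwise q)
    also have "\<dots> = m powr \<theta> * ((\<Sum>x\<in>A. q x) + (\<Sum>x\<in>A. q x * Y x) / m)"
      by (simp add: sum_distrib_left sum_distrib_right sum_divide_distrib sum.distrib algebra_simps)
    also have "\<dots> = 2 * m powr \<theta>" using assms(3) \<open>m > 0\<close> by (simp add: m_def)
    finally show ?thesis by (simp add: m_def)
  qed
qed

text \<open>
  Gibbs' inequality before summation, from \<open>ln (r / t) \<le> r / t - 1\<close>. The linear terms keep track of
  total masses, so \<open>r\<close> can be any positive weight instead of a probability.
\<close>
lemma entropy_term_le:
  fixes t r :: real
  assumes "t \<ge> 0" "r > 0"
  shows "- (t * ln t) \<le> - (t * ln r) + r - t"
proof (cases "t = 0")
  case False
  then have "t > 0" using assms by simp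
  have "ln (r / t) \<le> r / t - 1" using assms \<open>t > 0\<close> by (intro ln_le_minus_one) simp
  then have "t * (ln r - ln t) \<le> t * (r / t - 1)"
    using assms \<open>t > 0\<close> by (intro mult_left_mono) (simp_all add: ln_div)
  then show ?thesis using \<open>t > 0\<close> by (simp add: algebra_simps)
qed (use assms in simp)

text \<open>
  Relative entropy dominates the squared Hellinger distance: \<open>ln (sqrt (m / t)) \<le> sqrt (m / t) - 1\<close>
  multiplied by \<open>2 t\<close>. The terms \<open>- t + m\<close> disappear on summing over two probability distributions.
\<close>
lemma hellinger_le_relative_entropy:
  fixes t m :: real
  assumes "t \<ge> 0" "m > 0"
  shows "(sqrt t - sqrt m)\<^sup>2 \<le> t * ln t - t * ln m - t + m"
proof (cases "t = 0")
  case False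
  then have "t > 0" using assms by simp
  have "ln (sqrt (m / t)) \<le> sqrt (m / t) - 1"
    using assms \<open>t > 0\<close> by (intro ln_le_minus_one) simp
  then have "ln m - ln t \<le> 2 * (sqrt (m / t) - 1)"
    using assms \<open>t > 0\<close> by (simp add: ln_sqrt ln_div)
  then have "t * (ln m - ln t) \<le> t * (2 * (sqrt (m / t) - 1))"
    using \<open>t > 0\<close> by (intro mult_left_mono) auto
  then have "t * (ln m - ln t) \<le> 2 * (t * (sqrt (m / t) - 1))" by (simp add: algebra_simps)
  also have "t * sqrt (m / t) = sqrt t * sqrt m"
    using assms \<open>t > 0\<close> by (simp add: real_sqrt_divide real_div_sqrt field_simps)
  then have "2 * (t * (sqrt (m / t) - 1)) = 2 * (sqrt t * sqrt m) - 2 * t"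
    by (simp add: algebra_simps)
  finally show ?thesis using assms by (simp add: power2_diff algebra_simps)
qed (use assms in simp)

text \<open>
  The mean value theorem, with the value at the intermediate point bounded by the sum of the values
  at both ends so that the right-hand side is symmetric.
\<close>
lemma exp_minus_diff_le:
  fixes a b :: real
  shows "\<bar>exp (- a) - exp (- b)\<bar> \<le> \<bar>a - b\<bar> * (exp (- a) + exp (- b))"
proof (induction a b rule: linorder_wlog)
  case (le a b)
  have "exp (- a) - exp (- b) = exp (- a) * (1 - exp (- (b - a)))"
    by (simp add: algebra_simps exp_add[symmetric])
  also have "\<dots> \<le> exp (- a) * (b - a)"
    using exp_ge_add_one_self[of "- (b - a)"] by (intro mult_left_mono) (linarith, simp)
  also have "\<dots> \<le> (b - a) * (exp (- a) + exp (- b))" using le by (simp add: algebra_simps)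
  finally show ?case using le by simp
qed (simp add: abs_minus_commute add.commute)

lemma summable_stretched_exp:
  fixes a \<nu> :: real
  assumes "a > 0" "\<nu> > 0"
  shows "summable (\<lambda>r. exp (- a * real r powr \<nu>))"
proof -
  have "((\<lambda>r. exp (- a * real r powr \<nu>) / (1 / real r ^ 2)) \<longlongrightarrow> 0) sequentially"
    using assms by real_asymp
  then have "(\<lambda>r. exp (- a * real r powr \<nu>)) \<in> O(\<lambda>r. 1 / real r ^ 2)"
    by (intro smalloI_tendsto[THEN landau_o.small_imp_big])
       (auto intro!: eventually_sequentiallyI[of 1])
  moreover have "summable (\<lambda>r. norm (1 / real r ^ 2))"
    using inverse_power_summable[of 2, where 'a = real] by (simp add: inverse_eq_divide)
  ultimately show ?thesis by (rule summable_comparison_test_bigo[rotated])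
qed

text \<open>
  Positivity at the finitely many early times is what allows one constant for all of them.
\<close>
lemma eventual_bound_imp_bound:
  fixes f g :: "nat \<Rightarrow> real"
  assumes f: "\<And>n. n \<ge> 1 \<Longrightarrow> 0 < f n" and g: "\<And>n. n \<ge> 1 \<Longrightarrow> 0 < g n"
    and "c > 0" and ev: "\<And>n. n \<ge> N \<Longrightarrow> c * g n \<le> f n"
  shows "\<exists>c'>0. \<forall>n\<ge>1. c' * g n \<le> f n"
proof -
  define c' where "c' = Min (insert c ((\<lambda>n. f n / g n) ` {1..N}))"
  have "c' > 0" using assms by (auto simp: c'_def)
  moreover have "c' * g n \<le> f n" if "n \<ge> 1" for n
  proof (cases "n \<le> N")
    case True
    then have "c' \<le> f n / g n" unfolding c'_def using that by (intro Min_le) auto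
    then show ?thesis using g[OF that] by (simp add: field_simps)
  next
    case False
    have "c' * g n \<le> c * g n"
      using g[OF that] by (intro mult_right_mono) (auto simp: c'_def)
    then show ?thesis using ev[of n] False by simp
  qed
  ultimately show ?thesis by blast
qed

lemma sq_sum_le: "(a + b)\<^sup>2 \<le> 2 * (a\<^sup>2 + b\<^sup>2)" for a b :: real
  using sum_squares_bound[of a b] by (simp add: power2_sum)

text \<open>
  This is \<open>0 \<le> (a - 2 b)\<^sup>2\<close> divided by \<open>2\<close>.
\<close>
lemma sq_diff_ge: "a\<^sup>2 / 2 - b\<^sup>2 \<le> (a - b)\<^sup>2" for a b :: real
  using zero_le_power2[of "a - 2 * b"] by (simp add: power2_diff field_simps)

lemma sup_unit_le:
  assumes "0 \<le> b" "\<And>c. c \<in> X \<Longrightarrow> c \<le> b"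
  shows "sup_unit X \<le> b"
  using assms by (auto simp: sup_unit_def intro: cSup_least)

lemma sup_unit_ge:
  assumes "c \<in> X" "X \<subseteq> {0..1}"
  shows "c \<le> sup_unit X"
proof -
  have "bdd_above X" using assms by (meson bdd_above_Icc bdd_above_mono)
  then show ?thesis using assms by (auto simp: sup_unit_def intro: cSup_upper)
qed

lemma sup_unit_nonneg: "X \<subseteq> {0..1} \<Longrightarrow> 0 \<le> sup_unit X"
  using sup_unit_ge[of _ X] by (fastforce simp: sup_unit_def split: if_splits)

lemma sup_unit_in_unit: "X \<subseteq> {0..1} \<Longrightarrow> sup_unit X \<in> {0..1}"
  using sup_unit_nonneg[of X] sup_unit_le[of 1 X] by (auto simp: subset_iff)

section \<open>Word length in a finitely generated group\<close>

locale marked_group = group G for G :: "('a, 'm) monoid_scheme" (structure) +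
  fixes S :: "'a set"
  assumes symmetric_generating: "symmetric_generating_set G S"
begin

lemma
  shows finite_S: "finite S" and S_nonempty: "S \<noteq> {}" and S_carrier: "S \<subseteq> carrier G"
    and S_inv: "s \<in> S \<Longrightarrow> inv s \<in> S" and S_generates: "generate G S = carrier G"
  using symmetric_generating by (auto simp: symmetric_generating_set_def)

abbreviation len :: "'a \<Rightarrow> nat" where "len \<equiv> word_length G S"
abbreviation ball :: "nat \<Rightarrow> 'a set" where "ball \<equiv> word_ball G S"
abbreviation word :: "'a list \<Rightarrow> 'a" where "word w \<equiv> foldr (\<lambda>x y. x \<otimes> y) w \<one>"

lemma word_closed: "set w \<subseteq> S \<Longrightarrow> word w \<in> carrier G"
  using S_carrier by (induction w) auto

lemma word_append:
  "set v \<subseteq> S \<Longrightarrow> set w \<subseteq> S \<Longrightarrow> word (v @ w) = word v \<otimes> word w"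
proof (induction v)
  case Nil
  then show ?case by (simp add: word_closed)
next
  case (Cons a v)
  then show ?case using S_carrier word_closed by (auto simp: m_assoc)
qed

lemma ex_word:
  assumes "g \<in> carrier G"
  shows "\<exists>w. set w \<subseteq> S \<and> word w = g"
proof -
  have "g \<in> generate G S" using assms S_generates by simp
  then show ?thesis
  proof (induction rule: generate.induct)
    case one
    show ?case by (rule exI[of _ "[]"]) simp
  next
    case (incl h)
    then show ?case using S_carrier by (intro exI[of _ "[h]"]) auto
  next
    case (inv h)
    then show ?case using S_carrier S_inv by (intro exI[of _ "[inv h]"]) auto
  next
    case (eng h1 h2)
    then show ?case by (metis Un_subset_iff set_append word_append)
  qed
qed

lemma ex_shortest_word:
  assumes "g \<in> carrier G"
  obtains w where "set w \<subseteq> S" "length w = len g" "word w = g"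
proof -
  have "\<exists>n. \<exists>w. set w \<subseteq> S \<and> length w = n \<and> word w = g"
    using ex_word[OF assms] by blast
  from LeastI_ex[OF this] show ?thesis
    using that unfolding word_length_def by blast
qed

lemma len_word_le: "set w \<subseteq> S \<Longrightarrow> len (word w) \<le> length w"
  unfolding word_length_def by (rule Least_le) blast

lemma len_one [simp]: "len \<one> = 0"
  using len_word_le[of "[]"] by simp

lemma len_eq_0_iff: "g \<in> carrier G \<Longrightarrow> len g = 0 \<longleftrightarrow> g = \<one>"
  by (metis ex_shortest_word foldr_Nil id_apply len_one length_0_conv)

lemma len_mult: "g \<in> carrier G \<Longrightarrow> h \<in> carrier G \<Longrightarrow> len (g \<otimes> h) \<le> len g + len h"
  by (metis (no_types, lifting) Un_subset_iff ex_shortest_word len_word_le length_append set_append word_append)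

lemma len_generator: "s \<in> S \<Longrightarrow> len s \<le> 1"
  using len_word_le[of "[s]"] S_carrier by auto

lemma len_inv_le:
  assumes "g \<in> carrier G"
  shows "len (inv g) \<le> len g"
proof -
  have "\<exists>v. set v \<subseteq> S \<and> length v = length w \<and> word v = inv (word w)" if "set w \<subseteq> S" for w
    using that
  proof (induction w)
    case (Cons a w)
    then obtain v where v: "set v \<subseteq> S" "length v = length w" "word v = inv (word w)"
      by auto
    have "word (v @ [inv a]) = word v \<otimes> inv a"
      using word_append[of v "[inv a]"] v(1) Cons.prems S_inv S_carrier by auto
    also have "\<dots> = inv (word (a # w))"
      using v(3) Cons.prems S_carrier word_closed[of w] by (auto simp: inv_mult_group)
    finally show ?case
      using v Cons.prems S_inv by (intro exI[of _ "v @ [inv a]"]) auto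
  qed auto
  then show ?thesis using ex_shortest_word[OF assms] len_word_le by metis
qed

lemma len_inv [simp]: "g \<in> carrier G \<Longrightarrow> len (inv g) = len g"
  by (metis inv_closed inv_inv le_antisym len_inv_le)

lemma len_le_mult_inv: "g \<in> carrier G \<Longrightarrow> h \<in> carrier G \<Longrightarrow> len g \<le> len h + len (inv h \<otimes> g)"
  using len_mult[of h "inv h \<otimes> g"] by (simp add: m_assoc[symmetric])

lemma mem_ball: "g \<in> ball n \<longleftrightarrow> g \<in> carrier G \<and> len g \<le> n"
  by (simp add: word_ball_def)

lemma ball_subset_carrier: "ball n \<subseteq> carrier G"
  by (auto simp: mem_ball)

lemma finite_ball [simp]: "finite (ball n)"
proof (rule finite_subset)
  show "ball n \<subseteq> word ` {w. set w \<subseteq> S \<and> length w \<le> n}"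
  proof
    fix g assume "g \<in> ball n"
    then obtain w where "set w \<subseteq> S" "length w = len g" "word w = g" "len g \<le> n"
      using ex_shortest_word[of g] by (auto simp: mem_ball)
    then show "g \<in> word ` {w. set w \<subseteq> S \<and> length w \<le> n}" by auto
  qed
  show "finite (word ` {w. set w \<subseteq> S \<and> length w \<le> n})"
    using finite_lists_length_le[OF finite_S, of n] by simp
qed

lemma ball_mono: "m \<le> n \<Longrightarrow> ball m \<subseteq> ball n"
  by (auto simp: mem_ball)

lemma countable_carrier: "countable (carrier G)"
proof -
  have "carrier G = (\<Union>n. ball n)" by (auto simp: mem_ball)
  then show ?thesis by (simp add: countable_finite)
qed

end

section \<open>Convolution powers of the lazy step\<close>

context marked_group
begin

abbreviation step :: "'a pmf" where "step \<equiv> lazy_step G S"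
abbreviation walk :: "nat \<Rightarrow> 'a pmf" where "walk \<equiv> convolution_power G step"

lemma set_step: "set_pmf step = insert \<one> S"
  using finite_S S_nonempty
  by (simp add: lazy_step_def set_pmf_bernoulli UNIV_bool)

lemma finite_set_step [simp]: "finite (set_pmf step)"
  by (simp add: set_step finite_S)

lemma set_step_carrier: "set_pmf step \<subseteq> carrier G"
  using S_carrier by (simp add: set_step)

lemma pmf_step_one_ge: "1 / 2 \<le> pmf step \<one>"
  using finite_S S_nonempty by (simp add: pmf_lazy_step)

lemma step_inv: "map_pmf (\<lambda>x. inv x) step = step"
proof (rule pmf_eqI)
  fix g
  have inj: "inj_on (\<lambda>x. inv x) (set_pmf step)"
    using set_step_carrier by (intro inj_onI) (metis inv_inv subsetD)
  have img: "(\<lambda>x. inv x) ` set_pmf step = set_pmf step"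
  proof -
    have "(\<lambda>x. inv x) ` S = S"
    proof
      show "S \<subseteq> (\<lambda>x. inv x) ` S"
      proof
        fix s assume "s \<in> S"
        then show "s \<in> (\<lambda>x. inv x) ` S" using S_inv S_carrier by (intro image_eqI[of _ _ "inv s"]) auto
      qed
    qed (use S_inv in auto)
    then show ?thesis by (simp add: set_step)
  qed
  show "pmf (map_pmf (\<lambda>x. inv x) step) g = pmf step g"
  proof (cases "g \<in> set_pmf step")
    case True
    then have g: "g \<in> carrier G" "inv g \<in> set_pmf step"
      using set_step_carrier img by auto
    then have "pmf (map_pmf (\<lambda>x. inv x) step) (inv (inv g)) = pmf step (inv g)"
      by (intro pmf_map_inj inj)
    also have "\<dots> = pmf step g"
    proof -
      have "inv g = \<one> \<longleftrightarrow> g = \<one>" using g by simp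
      moreover have "inv g \<in> S \<longleftrightarrow> g \<in> S" using S_inv[of g] S_inv[of "inv g"] g by auto
      ultimately show ?thesis
        using finite_S S_nonempty by (simp add: pmf_lazy_step indicator_def)
    qed
    finally show ?thesis using g by simp
  next
    case False
    then show ?thesis using img by (metis pmf_eq_0_set_pmf set_map_pmf)
  qed
qed

lemma pmf_inv_eq:
  assumes "set_pmf p \<subseteq> carrier G" "map_pmf (\<lambda>x. inv x) p = p" "x \<in> carrier G"
  shows "pmf p (inv x) = pmf p x"
proof -
  have inj: "inj_on (\<lambda>x. inv x) (set_pmf p)"
    using assms(1) by (intro inj_onI) (metis inv_inv subsetD)
  have img: "(\<lambda>x. inv x) ` set_pmf p = set_pmf p"
    using set_map_pmf[of "\<lambda>x. inv x" p] by (simp add: assms(2))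
  show ?thesis
  proof (cases "x \<in> set_pmf p")
    case True
    then show ?thesis using pmf_map_inj[OF inj True] by (simp add: assms(2))
  next
    case False
    then have "inv x \<notin> set_pmf p"
      using img assms(3) by (metis imageI inv_inv)
    then show ?thesis using False by (metis pmf_eq_0_set_pmf)
  qed
qed

lemma pmf_step_inv:
  assumes "s \<in> set_pmf step"
  shows "pmf step (inv s) = pmf step s" "inv s \<in> set_pmf step"
proof -
  show "pmf step (inv s) = pmf step s"
    using assms set_step_carrier by (intro pmf_inv_eq step_inv) auto
  show "inv s \<in> set_pmf step"
    using assms by (metis step_inv imageI set_map_pmf)
qed

lemma convolution_eq_bind:
  "convolution G p q = bind_pmf q (\<lambda>s. map_pmf (\<lambda>x. x \<otimes> s) p)"
  unfolding convolution_def pair_pmf_def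
  by (subst bind_commute_pmf) (simp add: map_bind_pmf map_pmf_def bind_assoc_pmf bind_return_pmf)

lemma set_convolution:
  "set_pmf (convolution G p q) = (\<lambda>(x, y). x \<otimes> y) ` (set_pmf p \<times> set_pmf q)"
  by (simp add: convolution_def)

lemma pmf_convolution:
  assumes p: "set_pmf p \<subseteq> carrier G" and q: "set_pmf q \<subseteq> carrier G" "finite (set_pmf q)"
    and g: "g \<in> carrier G"
  shows "pmf (convolution G p q) g = (\<Sum>s\<in>set_pmf q. pmf q s * pmf p (g \<otimes> inv s))"
proof -
  have translate: "pmf (map_pmf (\<lambda>x. x \<otimes> s) p) g = pmf p (g \<otimes> inv s)" if "s \<in> set_pmf q" for s
  proof -
    have s: "s \<in> carrier G" using that q by auto
    have "pmf (map_pmf (\<lambda>x. x \<otimes> s) p) g = measure (measure_pmf p) ((\<lambda>x. x \<otimes> s) -` {g})"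
      by (simp add: pmf_map)
    also have "\<dots> = measure (measure_pmf p) {g \<otimes> inv s}"
    proof (rule measure_pmf.finite_measure_eq_AE)
      have "x \<otimes> s = g \<longleftrightarrow> x = g \<otimes> inv s" if "x \<in> carrier G" for x
        using that s g by (auto simp: inv_solve_right)
      then show "AE x in measure_pmf p. (x \<in> (\<lambda>x. x \<otimes> s) -` {g}) = (x \<in> {g \<otimes> inv s})"
        using p by (auto simp: AE_measure_pmf_iff)
    qed auto
    finally show ?thesis by (simp add: measure_pmf_single)
  qed
  show ?thesis
    unfolding convolution_eq_bind pmf_bind
    by (subst integral_measure_pmf_real[where A = "set_pmf q"]) (auto simp: q translate mult.commute)
qed

text \<open>
  The sums may run over any finite sets that contain the supports, so that laws at different times
  can be compared term by term.
\<close>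
lemma expectation_convolution:
  assumes "finite A" "set_pmf p \<subseteq> A" "finite B" "set_pmf q \<subseteq> B"
  shows "measure_pmf.expectation (convolution G p q) F
           = (\<Sum>x\<in>A. \<Sum>y\<in>B. pmf p x * pmf q y * F (x \<otimes> y))"
proof -
  have "measure_pmf.expectation (convolution G p q) F
      = (\<Sum>z\<in>A \<times> B. F (fst z \<otimes> snd z) * pmf (pair_pmf p q) z)"
    unfolding convolution_def integral_map_pmf case_prod_unfold
    by (rule integral_measure_pmf_real) (use assms in auto)
  also have "\<dots> = (\<Sum>x\<in>A. \<Sum>y\<in>B. pmf p x * pmf q y * F (x \<otimes> y))"
    by (subst sum.cartesian_product) (auto intro!: sum.cong simp: pmf_pair)
  finally show ?thesis .
qed

lemma convolution_assoc:
  assumes "set_pmf p \<subseteq> carrier G" "set_pmf q \<subseteq> carrier G" "set_pmf r \<subseteq> carrier G"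
  shows "convolution G (convolution G p q) r = convolution G p (convolution G q r)"
proof -
  have "convolution G (convolution G p q) r
      = bind_pmf r (\<lambda>s. bind_pmf q (\<lambda>t. map_pmf (\<lambda>x. (x \<otimes> t) \<otimes> s) p))"
    by (simp add: convolution_eq_bind map_bind_pmf pmf.map_comp o_def)
  also have "\<dots> = bind_pmf r (\<lambda>s. bind_pmf q (\<lambda>t. map_pmf (\<lambda>x. x \<otimes> (t \<otimes> s)) p))"
    using assms by (intro bind_pmf_cong refl pmf.map_cong) (auto intro!: m_assoc)
  also have "\<dots> = convolution G p (convolution G q r)"
    by (simp add: convolution_eq_bind bind_assoc_pmf bind_map_pmf)
  finally show ?thesis .
qed

lemma convolution_one:
  assumes "set_pmf p \<subseteq> carrier G"
  shows "convolution G (return_pmf \<one>) p = p" "convolution G p (return_pmf \<one>) = p"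
proof -
  have "convolution G (return_pmf \<one>) p = bind_pmf p return_pmf"
    unfolding convolution_eq_bind using assms by (intro bind_pmf_cong) auto
  then show "convolution G (return_pmf \<one>) p = p" by (simp add: bind_return_pmf')
  have "convolution G p (return_pmf \<one>) = map_pmf (\<lambda>x. x) p"
    unfolding convolution_eq_bind bind_return_pmf using assms by (intro pmf.map_cong) auto
  then show "convolution G p (return_pmf \<one>) = p" by simp
qed

lemma inv_convolution:
  assumes "set_pmf p \<subseteq> carrier G" "set_pmf q \<subseteq> carrier G"
  shows "map_pmf (\<lambda>x. inv x) (convolution G p q)
           = convolution G (map_pmf (\<lambda>x. inv x) q) (map_pmf (\<lambda>x. inv x) p)"
proof -
  have "map_pmf (\<lambda>x. inv x) (convolution G p q)
      = bind_pmf q (\<lambda>s. map_pmf (\<lambda>x. inv (x \<otimes> s)) p)"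
    by (simp add: convolution_eq_bind map_bind_pmf pmf.map_comp o_def)
  also have "\<dots> = bind_pmf q (\<lambda>s. map_pmf (\<lambda>x. inv s \<otimes> inv x) p)"
    using assms by (intro bind_pmf_cong refl pmf.map_cong) (auto intro!: inv_mult_group)
  also have "\<dots> = bind_pmf p (\<lambda>x. map_pmf (\<lambda>s. inv s \<otimes> inv x) q)"
    unfolding map_pmf_def by (rule bind_commute_pmf)
  also have "\<dots> = convolution G (map_pmf (\<lambda>x. inv x) q) (map_pmf (\<lambda>x. inv x) p)"
    by (simp add: convolution_eq_bind bind_map_pmf pmf.map_comp o_def)
  finally show ?thesis .
qed

lemma set_walk: "set_pmf (walk n) \<subseteq> ball n"
proof (induction n)
  case (Suc n)
  have "len (x \<otimes> s) \<le> Suc n" "x \<otimes> s \<in> carrier G" if "x \<in> set_pmf (walk n)" "s \<in> set_pmf step" for x s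
  proof -
    have x: "x \<in> carrier G" "len x \<le> n" using that Suc by (auto simp: mem_ball)
    have s: "s \<in> carrier G" "len s \<le> 1"
      using that set_step_carrier len_generator by (auto simp: set_step)
    show "x \<otimes> s \<in> carrier G" using x s by simp
    show "len (x \<otimes> s) \<le> Suc n" using len_mult[of x s] x s by simp
  qed
  then show ?case by (auto simp: set_convolution mem_ball)
qed (simp add: mem_ball)

lemma set_walk_carrier: "set_pmf (walk n) \<subseteq> carrier G"
  using set_walk ball_subset_carrier by blast

lemma walk_add: "walk (i + j) = convolution G (walk i) (walk j)"
  by (induction j) (simp_all add: convolution_one convolution_assoc set_walk_carrier set_step_carrier)

lemma walk_inv: "map_pmf (\<lambda>x. inv x) (walk n) = walk n"
proof (induction n)
  case (Suc n)
  have "map_pmf (\<lambda>x. inv x) (walk (Suc n)) = convolution G step (walk n)"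
    using Suc by (simp add: inv_convolution set_walk_carrier set_step_carrier step_inv)
  also have "\<dots> = walk (1 + n)"
    by (subst walk_add) (simp add: convolution_one set_step_carrier)
  finally show ?case by simp
qed simp

lemma pmf_walk_inv: "x \<in> carrier G \<Longrightarrow> pmf (walk n) (inv x) = pmf (walk n) x"
  by (rule pmf_inv_eq[OF set_walk_carrier walk_inv])

lemma pmf_walk_eq_0: "g \<notin> ball n \<Longrightarrow> pmf (walk n) g = 0"
  using set_walk by (auto simp: pmf_eq_0_set_pmf)

lemma set_walk_ball: "n \<le> N \<Longrightarrow> set_pmf (walk n) \<subseteq> ball N"
  using set_walk ball_mono by blast

lemma walk_expectation:
  assumes "n \<le> N"
  shows "measure_pmf.expectation (walk n) F = (\<Sum>x\<in>ball N. pmf (walk n) x * F x)"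
  using set_walk_ball[OF assms]
  by (subst integral_measure_pmf_real[where A = "ball N"]) (auto simp: mult.commute)

lemma sum_pmf_walk: "n \<le> N \<Longrightarrow> (\<Sum>x\<in>ball N. pmf (walk n) x) = 1"
  by (intro sum_pmf_eq_1 set_walk_ball) auto

lemma infsum_walk:
  assumes "n \<le> N"
  shows "(\<Sum>\<^sub>\<infinity>g\<in>carrier G. pmf (walk n) g * F g) = (\<Sum>x\<in>ball N. pmf (walk n) x * F x)"
proof -
  have "(\<Sum>\<^sub>\<infinity>g\<in>carrier G. pmf (walk n) g * F g) = (\<Sum>\<^sub>\<infinity>g\<in>ball N. pmf (walk n) g * F g)"
    using set_walk_ball[OF assms] ball_subset_carrier
    by (intro infsum_cong_neutral) (auto simp: pmf_eq_0_set_pmf)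
  then show ?thesis by simp
qed

lemma speed_eq: "n \<le> N \<Longrightarrow> speed G S n = (\<Sum>x\<in>ball N. pmf (walk n) x * real (len x))"
  unfolding speed_def using infsum_walk[of n N "\<lambda>g. real (len g)"] by (simp add: mult.commute)

lemma walk_entropy_eq:
  "n \<le> N \<Longrightarrow> walk_entropy G S n = - (\<Sum>x\<in>ball N. pmf (walk n) x * ln (pmf (walk n) x))"
  unfolding walk_entropy_def by (simp add: infsum_walk)

lemma speed_nonneg: "0 \<le> speed G S n"
  by (simp add: speed_eq[OF order_refl] sum_nonneg)

end

section \<open>Entropy increments control speed increments\<close>

context marked_group
begin

lemma len_step_le: "s \<in> set_pmf step \<Longrightarrow> len s \<le> 1"
  using len_generator by (auto simp: set_step)

lemma len_translate_diff:
  assumes "x \<in> carrier G" "s \<in> set_pmf step"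
  shows "\<bar>real (len x) - real (len (x \<otimes> inv s))\<bar> \<le> 1"
proof -
  have s: "s \<in> carrier G" "len s \<le> 1" "len (inv s) \<le> 1"
    using assms set_step_carrier len_step_le by auto
  have "len (x \<otimes> inv s) \<le> len x + 1"
    using len_mult[of x "inv s"] assms s by simp
  moreover have "x = x \<otimes> inv s \<otimes> s"
    using assms s by (simp add: m_assoc)
  then have "len x \<le> len (x \<otimes> inv s) + 1"
    using len_mult[of "x \<otimes> inv s" s] assms s by simp
  ultimately show ?thesis by linarith
qed

text \<open>
  A step moves each point by at most \<open>1\<close>, so the ball of radius \<open>N > n\<close> still contains the translate of
  everything that \<open>h\<close> sees.
\<close>
lemma sum_translate:
  assumes s: "s \<in> set_pmf step" and "Suc n \<le> N"
    and h: "\<And>x. x \<in> carrier G \<Longrightarrow> x \<notin> ball n \<Longrightarrow> h x = (0::real)"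
  shows "(\<Sum>x\<in>ball N. h (x \<otimes> inv s)) = (\<Sum>x\<in>ball N. h x)"
proof -
  have sc: "s \<in> carrier G" using s set_step_carrier by auto
  define A where "A = {x \<in> carrier G. x \<otimes> inv s \<in> ball n}"
  have sub: "A \<subseteq> ball N"
  proof
    fix x assume x: "x \<in> A"
    then show "x \<in> ball N"
      using len_translate_diff[of x s] s assms(2) by (auto simp: A_def mem_ball)
  qed
  have "(\<Sum>x\<in>ball N. h (x \<otimes> inv s)) = (\<Sum>x\<in>A. h (x \<otimes> inv s))"
    by (intro sum.mono_neutral_right sub finite_ball) (auto simp: A_def mem_ball sc intro!: h)
  also have "\<dots> = (\<Sum>x\<in>ball n. h x)"
  proof (rule sum.reindex_bij_witness[where j = "\<lambda>x. x \<otimes> inv s" and i = "\<lambda>x. x \<otimes> s"])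
  qed (auto simp: A_def mem_ball sc m_assoc)
  also have "\<dots> = (\<Sum>x\<in>ball N. h x)"
    using ball_mono[of n N] assms(2) by (intro sum.mono_neutral_left) (auto intro!: h simp: mem_ball)
  finally show ?thesis .
qed

text \<open>
  Cauchy-Schwarz for \<open>\<bar>t - u\<bar> = \<bar>sqrt t - sqrt u\<bar> * (sqrt t + sqrt u)\<close>; the second factor has square
  sum at most \<open>4\<close>.
\<close>
lemma total_variation_le:
  fixes t u :: "'a \<Rightarrow> real"
  assumes "\<And>x. x \<in> A \<Longrightarrow> 0 \<le> t x" "\<And>x. x \<in> A \<Longrightarrow> 0 \<le> u x"
    and "(\<Sum>x\<in>A. t x) = 1" "(\<Sum>x\<in>A. u x) = 1"
  shows "(\<Sum>x\<in>A. \<bar>t x - u x\<bar>)\<^sup>2 \<le> 4 * (\<Sum>x\<in>A. (sqrt (t x) - sqrt (u x))\<^sup>2)"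
proof -
  have eq: "\<bar>t x - u x\<bar> = \<bar>sqrt (t x) - sqrt (u x)\<bar> * (sqrt (t x) + sqrt (u x))" if "x \<in> A" for x
  proof -
    have "t x - u x = (sqrt (t x) - sqrt (u x)) * (sqrt (t x) + sqrt (u x))"
      using assms(1,2)[OF that] by (simp add: algebra_simps)
    then show ?thesis using assms(1,2)[OF that] by (simp add: abs_mult)
  qed
  have "(sqrt (t x) + sqrt (u x))\<^sup>2 \<le> 2 * (t x + u x)" if "x \<in> A" for x
    using assms(1,2)[OF that] sum_squares_bound[of "sqrt (t x)" "sqrt (u x)"]
    by (simp add: power2_sum)
  then have "(\<Sum>x\<in>A. (sqrt (t x) + sqrt (u x))\<^sup>2) \<le> (\<Sum>x\<in>A. 2 * (t x + u x))"
    by (rule sum_mono)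
  also have "\<dots> = 4" using assms(3,4) by (simp add: sum_distrib_left[symmetric] sum.distrib)
  finally have four: "(\<Sum>x\<in>A. (sqrt (t x) + sqrt (u x))\<^sup>2) \<le> 4" .
  have "(\<Sum>x\<in>A. \<bar>t x - u x\<bar>)\<^sup>2
      = (\<Sum>x\<in>A. \<bar>sqrt (t x) - sqrt (u x)\<bar> * (sqrt (t x) + sqrt (u x)))\<^sup>2"
    by (simp add: eq)
  also have "\<dots> \<le> (\<Sum>x\<in>A. \<bar>sqrt (t x) - sqrt (u x)\<bar>\<^sup>2) * (\<Sum>x\<in>A. (sqrt (t x) + sqrt (u x))\<^sup>2)"
    by (rule Cauchy_Schwarz_ineq_sum)
  also have "\<dots> \<le> (\<Sum>x\<in>A. (sqrt (t x) - sqrt (u x))\<^sup>2) * 4"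
    using four by (simp add: mult_left_mono sum_nonneg)
  finally show ?thesis by simp
qed

text \<open>
  Let \<open>q\<close> and \<open>q'\<close> be the laws at times \<open>n\<close> and \<open>n + 1\<close>, let \<open>l s\<close> be the probability of the step \<open>s\<close>,
  and let \<open>t s\<close> be the translate of \<open>q\<close> by \<open>s\<close>, so that \<open>q'\<close> is the \<open>l\<close>-average of the \<open>t s\<close>.

  Speed: since \<open>l\<close> is symmetric, moving the translation by \<open>s\<close> from the measure to the function gives
  \<open>2 (L' - L) = (\<Sum>s. l s * (\<Sum>x. (\<bar>x\<bar> - \<bar>x s\<^sup>-\<^sup>1\<bar>) * (t s x - q x)))\<close>. The first factor is at most \<open>1\<close> in
  absolute value, so \<open>L' - L\<close> is bounded by averages of the distances of \<open>t s\<close> to \<open>q\<close>.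
  The triangle inequality through \<open>q'\<close> replaces them by the distances \<open>d s\<close> of \<open>t s\<close> to \<open>q'\<close>; because
  \<open>q = t \<one>\<close> and the walk is lazy, the extra term \<open>d \<one>\<close> is at most twice the average of \<open>d\<close>.

  Entropy: all translates \<open>t s\<close> have the entropy of \<open>q\<close>, so \<open>H' - H\<close> is the average of the entropies of
  the \<open>t s\<close> relative to \<open>q'\<close>. These dominate the squared Hellinger distances \<open>k s\<close>, which dominate
  \<open>(d s)\<^sup>2 / 4\<close>.
\<close>
lemma speed_increment_le:
  shows "speed G S (Suc n) - speed G S n
           \<le> 3 * sqrt (walk_entropy G S (Suc n) - walk_entropy G S n)"
    and "walk_entropy G S n \<le> walk_entropy G S (Suc n)"
proof -
  \<comment> \<open>any radius that contains the supports at times n and n + 1 and their translates by one step\<close>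
  define N where "N = n + 2"
  define q where "q = pmf (walk n)"
  define q' where "q' = pmf (walk (Suc n))"
  define T where "T = set_pmf step"
  define l where "l = pmf step"
  define t where "t = (\<lambda>s x. q (x \<otimes> inv s))"
  define B where "B = ball N"
  define L where "L = speed G S n"
  define L' where "L' = speed G S (Suc n)"
  define H where "H = walk_entropy G S n"
  define H' where "H' = walk_entropy G S (Suc n)"
  have Bc: "x \<in> carrier G" if "x \<in> B" for x using that by (auto simp: B_def mem_ball)
  have finT: "finite T" and Tc: "s \<in> T \<Longrightarrow> s \<in> carrier G" and oneT: "\<one> \<in> T" for s
    using set_step_carrier by (auto simp: T_def set_step finite_S)
  have l_pos: "s \<in> T \<Longrightarrow> l s > 0" and l_nonneg: "0 \<le> l s" for s
    by (auto simp: l_def T_def intro: pmf_positive)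
  have l_sum: "(\<Sum>s\<in>T. l s) = 1" unfolding l_def T_def by (intro sum_pmf_eq_1) auto
  have nonneg: "0 \<le> t s x" "0 \<le> q x" "0 \<le> q' x" for s x by (auto simp: t_def q_def q'_def)
  have q_out: "q x = 0" if "x \<notin> ball n" for x
    using that pmf_walk_eq_0 by (simp add: q_def)
  have translate: "(\<Sum>x\<in>B. h (x \<otimes> inv s)) = (\<Sum>x\<in>B. h x)"
    if "s \<in> T" "\<And>x. x \<notin> ball n \<Longrightarrow> h x = 0" for s and h :: "'a \<Rightarrow> real"
    unfolding B_def by (rule sum_translate[where n = n]) (use that in \<open>auto simp: T_def N_def\<close>)
  have q': "q' x = (\<Sum>s\<in>T. l s * t s x)" if "x \<in> B" for x
    unfolding q'_def T_def l_def t_def q_def using Bc[OF that]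
    by (simp add: pmf_convolution set_walk_carrier set_step_carrier)
  have sum_q': "(\<Sum>x\<in>B. q' x) = 1" and sum_q: "(\<Sum>x\<in>B. q x) = 1"
    using sum_pmf_walk by (auto simp: q'_def q_def B_def N_def simp del: convolution_power.simps)
  have sum_t: "(\<Sum>x\<in>B. t s x) = 1" if "s \<in> T" for s
    unfolding t_def using translate[OF that, of q] q_out sum_q by simp
  have swap: "(\<Sum>s\<in>T. l s * (\<Sum>x\<in>B. t s x * h x)) = (\<Sum>x\<in>B. q' x * h x)" for h
  proof -
    have "(\<Sum>s\<in>T. l s * (\<Sum>x\<in>B. t s x * h x)) = (\<Sum>x\<in>B. \<Sum>s\<in>T. l s * t s x * h x)"
      by (subst sum.swap) (simp add: sum_distrib_left mult.assoc)
    also have "\<dots> = (\<Sum>x\<in>B. q' x * h x)" by (simp add: q' sum_distrib_right)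
    finally show ?thesis .
  qed

  have L': "L' = (\<Sum>x\<in>B. q' x * real (len x))"
    unfolding L'_def q'_def B_def by (rule speed_eq) (simp add: N_def)
  have L: "L = (\<Sum>x\<in>B. q x * real (len x))"
    unfolding L_def q_def B_def by (rule speed_eq) (simp add: N_def)
  have L_translate: "(\<Sum>x\<in>B. t s x * real (len (x \<otimes> inv s))) = L" if "s \<in> T" for s
    unfolding t_def L using translate[OF that, of "\<lambda>x. q x * real (len x)"] q_out by simp
  have L'_translate: "(\<Sum>s\<in>T. l s * (\<Sum>x\<in>B. q x * real (len (x \<otimes> inv s)))) = L'"
  proof -
    have "L' = measure_pmf.expectation (walk (Suc n)) (\<lambda>x. real (len x))"
      unfolding L' B_def q'_def by (rule walk_expectation[symmetric]) (simp add: N_def)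
    also have "\<dots> = (\<Sum>x\<in>B. \<Sum>s\<in>T. q x * l s * real (len (x \<otimes> s)))"
      unfolding convolution_power.simps q_def l_def
      by (rule expectation_convolution) (use set_walk_ball[of n N] in \<open>auto simp: B_def T_def N_def\<close>)
    also have "\<dots> = (\<Sum>s\<in>T. l s * (\<Sum>x\<in>B. q x * real (len (x \<otimes> s))))"
      by (subst sum.swap) (simp add: sum_distrib_left mult_ac)
    also have "\<dots> = (\<Sum>s\<in>T. l s * (\<Sum>x\<in>B. q x * real (len (x \<otimes> inv s))))"
    proof (rule sum.reindex_bij_witness[where i = "\<lambda>s. inv s" and j = "\<lambda>s. inv s"])
    qed (auto simp: T_def l_def pmf_step_inv Tc[unfolded T_def])
    finally show ?thesis by simp
  qed

  define d where "d = (\<lambda>s. \<Sum>x\<in>B. \<bar>t s x - q' x\<bar>)"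
  define k where "k = (\<lambda>s. \<Sum>x\<in>B. (sqrt (t s x) - sqrt (q' x))\<^sup>2)"
  have d_nonneg: "0 \<le> d s" for s by (simp add: d_def sum_nonneg)

  \<comment> \<open>each of the four sums is one of the two speeds, by translation and by symmetry of the step\<close>
  have "2 * (L' - L) = (\<Sum>s\<in>T. l s * (\<Sum>x\<in>B. t s x * real (len x))) - (\<Sum>s\<in>T. l s * L)
      - (\<Sum>s\<in>T. l s * L) + (\<Sum>s\<in>T. l s * (\<Sum>x\<in>B. q x * real (len (x \<otimes> inv s))))"
    unfolding swap L'_translate L'[symmetric] sum_distrib_right[symmetric] l_sum by simp
  also have "\<dots> = (\<Sum>s\<in>T. l s * ((\<Sum>x\<in>B. t s x * real (len x))
      - (\<Sum>x\<in>B. t s x * real (len (x \<otimes> inv s)))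
      - (\<Sum>x\<in>B. q x * real (len x)) + (\<Sum>x\<in>B. q x * real (len (x \<otimes> inv s)))))"
    by (simp add: L_translate L[symmetric] sum.distrib sum_subtractf sum_distrib_left[of 2] algebra_simps)
  also have "\<dots> = (\<Sum>s\<in>T. l s *
      (\<Sum>x\<in>B. (real (len x) - real (len (x \<otimes> inv s))) * (t s x - q x)))"
    by (simp add: sum.distrib[symmetric] sum_subtractf[symmetric] algebra_simps)
  also have "\<dots> \<le> (\<Sum>s\<in>T. l s * (d s + d \<one>))"
  proof (intro sum_mono mult_left_mono l_nonneg)
    fix s assume s: "s \<in> T"
    have "(\<Sum>x\<in>B. (real (len x) - real (len (x \<otimes> inv s))) * (t s x - q x))
        \<le> (\<Sum>x\<in>B. \<bar>t s x - q' x\<bar> + \<bar>t \<one> x - q' x\<bar>)"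
    proof (rule sum_mono)
      fix x assume x: "x \<in> B"
      have "(real (len x) - real (len (x \<otimes> inv s))) * (t s x - q x)
          \<le> \<bar>real (len x) - real (len (x \<otimes> inv s))\<bar> * \<bar>t s x - q x\<bar>"
        by (simp add: abs_mult[symmetric])
      also have "\<dots> \<le> 1 * \<bar>t s x - q x\<bar>"
        using s x Bc by (intro mult_right_mono len_translate_diff) (auto simp: T_def)
      also have "t \<one> x = q x" using Bc[OF x] by (simp add: t_def)
      then have "1 * \<bar>t s x - q x\<bar> \<le> \<bar>t s x - q' x\<bar> + \<bar>t \<one> x - q' x\<bar>" by simp
      finally show "(real (len x) - real (len (x \<otimes> inv s))) * (t s x - q x)
          \<le> \<bar>t s x - q' x\<bar> + \<bar>t \<one> x - q' x\<bar>" .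
    qed
    also have "\<dots> = d s + d \<one>" by (simp add: d_def sum.distrib)
    finally show "(\<Sum>x\<in>B. (real (len x) - real (len (x \<otimes> inv s))) * (t s x - q x)) \<le> d s + d \<one>" .
  qed
  also have "\<dots> = (\<Sum>s\<in>T. l s * d s) + d \<one>"
    by (simp add: sum.distrib ring_distribs sum_distrib_right[symmetric] l_sum)
  also have "\<dots> \<le> 3 * (\<Sum>s\<in>T. l s * d s)"
  proof -
    \<comment> \<open>laziness: the step is trivial with probability at least one half\<close>
    have "d \<one> \<le> 2 * (l \<one> * d \<one>)"
      using pmf_step_one_ge d_nonneg[of \<one>] mult_right_mono[of "1/2" "l \<one>" "d \<one>"] by (simp add: l_def)
    also have "l \<one> * d \<one> \<le> (\<Sum>s\<in>T. l s * d s)"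
      using finT oneT by (intro member_le_sum) (auto simp: l_nonneg d_nonneg)
    finally show ?thesis by simp
  qed
  finally have speed_bound: "2 * (L' - L) \<le> 3 * (\<Sum>s\<in>T. l s * d s)" .

  have "(\<Sum>s\<in>T. l s * k s) \<le> (\<Sum>s\<in>T. l s * (\<Sum>x\<in>B. t s x * ln (t s x) - t s x * ln (q' x) - t s x + q' x))"
  proof (intro sum_mono mult_left_mono l_nonneg)
    fix s assume s: "s \<in> T"
    show "k s \<le> (\<Sum>x\<in>B. t s x * ln (t s x) - t s x * ln (q' x) - t s x + q' x)"
      unfolding k_def
    proof (rule sum_mono)
      fix x assume x: "x \<in> B"
      show "(sqrt (t s x) - sqrt (q' x))\<^sup>2 \<le> t s x * ln (t s x) - t s x * ln (q' x) - t s x + q' x"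
      \<comment> \<open>where the average of the translates vanishes, so does each of them, and ln 0 is multiplied by 0\<close>
      proof (cases "q' x = 0")
        case True
        then have "\<forall>s\<in>T. l s * t s x = 0"
          unfolding q'[OF x] using finT l_nonneg nonneg by (subst (asm) sum_nonneg_eq_0_iff) auto
        then have "t s x = 0" using s l_pos[OF s] by auto
        then show ?thesis using True by simp
      next
        case False
        then show ?thesis
          using nonneg by (intro hellinger_le_relative_entropy) (auto simp: less_le)
      qed
    qed
  qed
  also have "\<dots> = (\<Sum>s\<in>T. l s * ((\<Sum>x\<in>B. t s x * ln (t s x)) - (\<Sum>x\<in>B. t s x * ln (q' x))))"
    by (intro sum.cong refl) (simp add: sum.distrib sum_subtractf sum_t sum_q')
  also have "\<dots> = (\<Sum>s\<in>T. l s * (- H)) - (\<Sum>s\<in>T. l s * (\<Sum>x\<in>B. t s x * ln (q' x)))"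
  proof -
    have H_translate: "(\<Sum>x\<in>B. t s x * ln (t s x)) = - H" if "s \<in> T" for s
    proof -
      have "(\<Sum>x\<in>B. t s x * ln (t s x)) = (\<Sum>x\<in>B. q x * ln (q x))"
        unfolding t_def using translate[OF that, of "\<lambda>x. q x * ln (q x)"] q_out by simp
      also have "\<dots> = - H"
        unfolding H_def q_def B_def by (subst walk_entropy_eq[of _ N]) (simp_all add: N_def)
      finally show ?thesis .
    qed
    show ?thesis by (simp add: H_translate right_diff_distrib sum_subtractf sum_negf)
  qed
  also have "\<dots> = H' - H"
  proof -
    have "H' = - (\<Sum>x\<in>B. q' x * ln (q' x))"
      unfolding H'_def q'_def B_def by (rule walk_entropy_eq) (simp add: N_def)
    then show ?thesis by (simp add: swap sum_distrib_right[symmetric] l_sum sum_negf)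
  qed
  finally have entropy_bound: "(\<Sum>s\<in>T. l s * k s) \<le> H' - H" .

  have "(\<Sum>s\<in>T. l s * d s)\<^sup>2 = (\<Sum>s\<in>T. sqrt (l s) * (sqrt (l s) * d s))\<^sup>2"
    by (simp add: l_nonneg mult.assoc[symmetric])
  also have "\<dots> \<le> (\<Sum>s\<in>T. (sqrt (l s))\<^sup>2) * (\<Sum>s\<in>T. (sqrt (l s) * d s)\<^sup>2)"
    by (rule Cauchy_Schwarz_ineq_sum)
  also have "\<dots> = (\<Sum>s\<in>T. l s * (d s)\<^sup>2)"
    by (simp add: l_nonneg l_sum power_mult_distrib)
  also have "\<dots> \<le> (\<Sum>s\<in>T. l s * (4 * k s))"
    unfolding d_def k_def
    by (intro sum_mono mult_left_mono l_nonneg total_variation_le nonneg sum_t sum_q')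
  also have "\<dots> = 4 * (\<Sum>s\<in>T. l s * k s)" by (simp add: sum_distrib_left mult_ac)
  finally have d_bound: "(\<Sum>s\<in>T. l s * d s)\<^sup>2 \<le> 4 * (H' - H)" using entropy_bound by simp
  show "walk_entropy G S n \<le> walk_entropy G S (Suc n)"
    using order_trans[OF zero_le_power2 d_bound] by (simp add: H_def H'_def)
  have "(\<Sum>s\<in>T. l s * d s) \<le> sqrt (4 * (H' - H))" using d_bound by (rule real_le_rsqrt)
  also have "\<dots> = 2 * sqrt (H' - H)" by (simp only: real_sqrt_mult real_sqrt_four)
  finally have "3 * (\<Sum>s\<in>T. l s * d s) \<le> 3 * (2 * sqrt (H' - H))"
    by (rule mult_left_mono) simp
  from order_trans[OF speed_bound this]
  show "speed G S (Suc n) - speed G S n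
      \<le> 3 * sqrt (walk_entropy G S (Suc n) - walk_entropy G S n)"
    by (simp add: L_def L'_def H_def H'_def)
qed

text \<open>
  Cauchy-Schwarz in time: the square roots of the entropy increments are summed, and the increments
  themselves telescope.
\<close>
lemma speed_squared_le: "(speed G S n)\<^sup>2 \<le> 9 * real n * walk_entropy G S n"
proof -
  define a where "a = (\<lambda>i. walk_entropy G S (Suc i) - walk_entropy G S i)"
  have a_nonneg: "0 \<le> a i" for i using speed_increment_le(2) by (simp add: a_def)
  have zero: "speed G S 0 = 0" "walk_entropy G S 0 = 0"
    by (simp_all add: speed_eq[of 0 0] walk_entropy_eq[of 0 0] indicator_def mem_ball sum.neutral)
  have "speed G S n \<le> 3 * (\<Sum>i<n. sqrt (a i))"
  proof (induction n)
    case (Suc n)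
    then show ?case using speed_increment_le(1)[of n] by (simp add: a_def)
  qed (simp add: zero)
  then have "(speed G S n)\<^sup>2 \<le> (3 * (\<Sum>i<n. 1 * sqrt (a i)))\<^sup>2"
    using speed_nonneg by (intro power_mono) auto
  also have "\<dots> = 9 * (\<Sum>i<n. 1 * sqrt (a i))\<^sup>2" by (simp add: power_mult_distrib)
  also have "\<dots> \<le> 9 * ((\<Sum>i<n. 1\<^sup>2) * (\<Sum>i<n. (sqrt (a i))\<^sup>2))"
    by (intro mult_left_mono Cauchy_Schwarz_ineq_sum) simp
  also have "\<dots> = 9 * real n * (\<Sum>i<n. a i)" by (simp add: a_nonneg)
  also have "(\<Sum>i<n. a i) = walk_entropy G S n"
    unfolding a_def by (subst sum_lessThan_telescope) (simp add: zero)
  finally show ?thesis .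
qed

end

section \<open>Stretched exponential growth, entropy and speed\<close>

locale stretched_growth = marked_group +
  fixes K L \<nu> :: real
  assumes K_pos: "K > 0" and L_pos: "L > 0" and \<nu>_pos: "\<nu> > 0" and \<nu>_le_1: "\<nu> \<le> 1"
    and growth: "\<And>n. n \<ge> 1 \<Longrightarrow> real (card (ball n)) \<le> L * exp (K * real n powr \<nu>)"
begin

text \<open>
  Summation over spheres. The identity is left out so that the bound tends to \<open>0\<close> as \<open>a\<close> grows, which
  \<open>ex_thin_tail\<close> relies on.
\<close>
lemma sum_stretched_exp_le:
  assumes "finite X" "X \<subseteq> carrier G - {\<one>}" "a > K"
  shows "(\<Sum>x\<in>X. exp (- a * real (len x) powr \<nu>))
           \<le> L * (\<Sum>r. exp (- (a - K) * real (Suc r) powr \<nu>))"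
proof -
  have pos: "len x \<ge> 1" if "x \<in> X" for x
    using that assms(2) len_eq_0_iff[of x] by fastforce
  have summable: "summable (\<lambda>r. exp (- (a - K) * real (Suc r) powr \<nu>))"
    using summable_stretched_exp[of "a - K" \<nu>] assms \<nu>_pos by (subst summable_Suc_iff) auto
  have sphere: "(\<Sum>x | x \<in> X \<and> len x = r. exp (- a * real (len x) powr \<nu>))
      \<le> L * exp (- (a - K) * real r powr \<nu>)" if "r \<ge> 1" for r
  proof -
    have "(\<Sum>x | x \<in> X \<and> len x = r. exp (- a * real (len x) powr \<nu>))
        = real (card {x \<in> X. len x = r}) * exp (- a * real r powr \<nu>)" by simp
    also have "card {x \<in> X. len x = r} \<le> card (ball r)"
      using assms(2) by (intro card_mono) (auto simp: mem_ball)
    then have "real (card {x \<in> X. len x = r}) * exp (- a * real r powr \<nu>)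
        \<le> L * exp (K * real r powr \<nu>) * exp (- a * real r powr \<nu>)"
      using growth[OF that] by (intro mult_right_mono) auto
    also have "\<dots> = L * exp (- (a - K) * real r powr \<nu>)"
      by (simp add: exp_add[symmetric] algebra_simps)
    finally show ?thesis .
  qed
  have "(\<Sum>x\<in>X. exp (- a * real (len x) powr \<nu>))
      = (\<Sum>r\<in>len ` X. \<Sum>x | x \<in> X \<and> len x = r. exp (- a * real (len x) powr \<nu>))"
    by (rule sum.image_gen[OF assms(1)])
  also have "\<dots> \<le> (\<Sum>r\<in>len ` X. L * exp (- (a - K) * real r powr \<nu>))"
    using pos by (intro sum_mono sphere) auto
  also have "\<dots> = L * (\<Sum>r\<in>len ` X. exp (- (a - K) * real r powr \<nu>))"
    by (simp add: sum_distrib_left)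
  also have "(\<Sum>r\<in>len ` X. exp (- (a - K) * real r powr \<nu>))
      = (\<Sum>r\<in>(\<lambda>r. r - 1) ` len ` X. exp (- (a - K) * real (Suc r) powr \<nu>))"
  proof -
    have "inj_on (\<lambda>r. r - 1) (len ` X)"
    proof (rule inj_onI)
      fix r r' assume "r \<in> len ` X" "r' \<in> len ` X" "r - 1 = r' - 1"
      moreover from this have "1 \<le> r" "1 \<le> r'" using pos by auto
      ultimately show "r = r'" by linarith
    qed
    then show ?thesis
      using pos by (subst (2) sum.reindex) (auto intro!: sum.cong simp: Suc_le_eq)
  qed
  also have "\<dots> \<le> (\<Sum>r. exp (- (a - K) * real (Suc r) powr \<nu>))"
    using assms by (intro sum_le_suminf summable) auto
  finally show ?thesis using L_pos by simp
qed

end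

context marked_group
begin

definition moment :: "nat \<Rightarrow> real \<Rightarrow> real" where
  "moment n \<theta> = (\<Sum>x\<in>ball n. pmf (walk n) x * real (len x) powr \<theta>)"

lemma moment_1: "moment n 1 = speed G S n"
  by (simp add: moment_def speed_eq[OF order_refl])

lemma moment_le:
  assumes "0 < \<theta>" "\<theta> \<le> \<rho>"
  shows "moment n \<theta> \<le> 2 * moment n \<rho> powr (\<theta> / \<rho>)"
proof -
  have "moment n \<theta> = (\<Sum>x\<in>ball n. pmf (walk n) x * (real (len x) powr \<rho>) powr (\<theta> / \<rho>))"
    using assms by (simp add: moment_def powr_powr)
  also have "\<dots> \<le> 2 * moment n \<rho> powr (\<theta> / \<rho>)"
    unfolding moment_def by (rule mean_powr_le) (use assms in \<open>auto simp: sum_pmf_walk\<close>)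
  finally show ?thesis .
qed

lemma speed_exponent_nonneg: "0 \<le> speed_exponent G S"
  unfolding speed_exponent_def by (rule sup_unit_nonneg) auto

text \<open>
  At speed zero the walk sits at the identity, where the entropy vanishes.
\<close>
lemma speed_pos:
  assumes "walk_entropy G S n > 0"
  shows "speed G S n > 0"
proof (rule ccontr)
  assume "\<not> speed G S n > 0"
  then have "(\<Sum>x\<in>ball n. pmf (walk n) x * real (len x)) = 0"
    using speed_nonneg[of n] by (simp add: speed_eq[OF order_refl])
  then have *: "\<forall>x\<in>ball n. pmf (walk n) x * real (len x) = 0"
    by (subst (asm) sum_nonneg_eq_0_iff) auto
  have "pmf (walk n) x * ln (pmf (walk n) x) = 0" if x: "x \<in> ball n" for x
  proof (cases "x = \<one>")
    case False
    then have "len x \<noteq> 0" using x len_eq_0_iff by (auto simp: mem_ball)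
    then show ?thesis using * x by auto
  next
    case True
    have "(\<Sum>y\<in>ball n. pmf (walk n) y) = (\<Sum>y\<in>{\<one>}. pmf (walk n) y)"
      using * len_eq_0_iff by (intro sum.mono_neutral_right) (force simp: mem_ball)+
    then show ?thesis using True by (simp add: sum_pmf_walk)
  qed
  then have "walk_entropy G S n = 0" by (simp add: walk_entropy_eq[OF order_refl] sum.neutral)
  then show False using assms by simp
qed

end

context stretched_growth
begin

text \<open>
  Gibbs' inequality against \<open>r x = exp (- 2 K \<bar>x\<bar>\<^sup>\<nu>)\<close>. The exponent is twice the growth rate, so half of
  it absorbs the growth of the spheres and the total mass \<open>1 + D\<close> of \<open>r\<close> is finite.
\<close>
lemma entropy_le_moment: "\<exists>C>0. \<forall>n. walk_entropy G S n \<le> C + 2 * K * moment n \<nu>"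
proof -
  define D where "D = L * (\<Sum>r. exp (- (2 * K - K) * real (Suc r) powr \<nu>))"
  have "walk_entropy G S n \<le> 1 + \<bar>D\<bar> + 2 * K * moment n \<nu>" for n
  proof -
    define r where "r = (\<lambda>x. exp (- (2 * K) * real (len x) powr \<nu>))"
    define q where "q = pmf (walk n)"
    have "walk_entropy G S n = (\<Sum>x\<in>ball n. - (q x * ln (q x)))"
      by (simp add: walk_entropy_eq[OF order_refl] sum_negf q_def)
    also have "\<dots> \<le> (\<Sum>x\<in>ball n. - (q x * ln (r x)) + r x - q x)"
      by (intro sum_mono entropy_term_le) (auto simp: q_def r_def)
    also have "\<dots> = 2 * K * moment n \<nu> + (\<Sum>x\<in>ball n. r x) - 1"
      by (simp add: r_def sum.distrib sum_subtractf q_def sum_pmf_walk moment_def sum_distrib_left mult_ac)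
    also have "(\<Sum>x\<in>ball n. r x) = r \<one> + (\<Sum>x\<in>ball n - {\<one>}. r x)"
      by (rule sum.remove) (auto simp: mem_ball)
    also have "r \<one> = 1" by (simp add: r_def)
    also have "(\<Sum>x\<in>ball n - {\<one>}. r x) \<le> D"
      unfolding r_def D_def using K_pos
      by (intro sum_stretched_exp_le) (auto simp: mem_ball)
    finally show ?thesis by simp
  qed
  then show ?thesis by (intro exI[of _ "1 + \<bar>D\<bar>"]) auto
qed

lemma entropy_le_speed: "\<exists>C>0. \<forall>n. walk_entropy G S n \<le> C + 4 * K * speed G S n powr \<nu>"
proof -
  obtain C where "C > 0" and C: "\<And>n. walk_entropy G S n \<le> C + 2 * K * moment n \<nu>"
    using entropy_le_moment by blast
  have "walk_entropy G S n \<le> C + 4 * K * speed G S n powr \<nu>" for n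
  proof -
    have "2 * K * moment n \<nu> \<le> 2 * K * (2 * speed G S n powr \<nu>)"
      using moment_le[of \<nu> 1 n] \<nu>_pos \<nu>_le_1 K_pos by (intro mult_left_mono) (auto simp: moment_1)
    then show ?thesis using C[of n] by simp
  qed
  then show ?thesis using \<open>C > 0\<close> by blast
qed

text \<open>
  Once the speed exceeds \<open>1\<close>, the constant in \<open>entropy_le_speed\<close> is absorbed into the power, and
  \<open>l\<^sup>2 \<le> 9 n H n \<le> D n l\<^sup>\<nu>\<close> can be solved for \<open>l\<close>.
\<close>
lemma speed_upper_bound: "\<exists>K'>0. \<forall>n\<ge>1. speed G S n \<le> K' * real n powr (1 / (2 - \<nu>))"
proof -
  obtain C where "C > 0" and C: "\<And>n. walk_entropy G S n \<le> C + 4 * K * speed G S n powr \<nu>"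
    using entropy_le_speed by blast
  define D where "D = 9 * (C + 4 * K)"
  have "D > 0" using \<open>C > 0\<close> K_pos by (simp add: D_def)
  define K' where "K' = 1 + D powr (1 / (2 - \<nu>))"
  have "speed G S n \<le> K' * real n powr (1 / (2 - \<nu>))" if "n \<ge> 1" for n
  proof (cases "speed G S n \<le> 1")
    case True
    have "1 * 1 \<le> K' * real n powr (1 / (2 - \<nu>))"
      using that \<nu>_le_1 by (intro mult_mono ge_one_powr_ge_zero) (auto simp: K'_def)
    then show ?thesis using True by simp
  next
    case False
    define l where "l = speed G S n"
    have l: "l > 1" using False by (simp add: l_def)
    have "l powr (2 - \<nu>) * l powr \<nu> = l\<^sup>2"
      using l by (simp add: powr_add[symmetric])
    also have "\<dots> \<le> 9 * real n * walk_entropy G S n"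
      unfolding l_def by (rule speed_squared_le)
    also have "\<dots> \<le> 9 * real n * (C * l powr \<nu> + 4 * K * l powr \<nu>)"
    proof (intro mult_left_mono)
      have "1 \<le> l powr \<nu>" using l \<nu>_pos by (intro ge_one_powr_ge_zero) auto
      then have "C * 1 \<le> C * l powr \<nu>" using \<open>C > 0\<close> by (intro mult_left_mono) auto
      then show "walk_entropy G S n \<le> C * l powr \<nu> + 4 * K * l powr \<nu>"
        using C[of n] by (simp add: l_def)
    qed simp
    also have "\<dots> = (D * real n) * l powr \<nu>" by (simp add: D_def algebra_simps)
    finally have "l powr (2 - \<nu>) \<le> D * real n"
      using l by (simp add: mult_le_cancel_right)
    then have "(l powr (2 - \<nu>)) powr (1 / (2 - \<nu>)) \<le> (D * real n) powr (1 / (2 - \<nu>))"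
      using \<nu>_le_1 by (intro powr_mono2) auto
    then have "l \<le> D powr (1 / (2 - \<nu>)) * real n powr (1 / (2 - \<nu>))"
      using l \<nu>_le_1 \<open>D > 0\<close> by (simp add: powr_powr powr_mult)
    also have "\<dots> \<le> K' * real n powr (1 / (2 - \<nu>))"
      by (intro mult_right_mono) (auto simp: K'_def)
    finally show ?thesis by (simp add: l_def)
  qed
  moreover have "K' > 0" unfolding K'_def by (smt (verit) powr_ge_zero)
  ultimately show ?thesis by blast
qed

lemma entropy_upper_bound:
  "\<exists>K''>0. \<exists>L''>0. \<forall>n\<ge>1. walk_entropy G S n \<le> L'' + K'' * real n powr (\<nu> / (2 - \<nu>))"
proof -
  obtain C where "C > 0" and C: "\<And>n. walk_entropy G S n \<le> C + 4 * K * speed G S n powr \<nu>"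
    using entropy_le_speed by blast
  obtain K' where "K' > 0" and K': "\<And>n. n \<ge> 1 \<Longrightarrow> speed G S n \<le> K' * real n powr (1 / (2 - \<nu>))"
    using speed_upper_bound by blast
  have "walk_entropy G S n \<le> C + (4 * K * K' powr \<nu>) * real n powr (\<nu> / (2 - \<nu>))" if "n \<ge> 1" for n
  proof -
    have "speed G S n powr \<nu> \<le> (K' * real n powr (1 / (2 - \<nu>))) powr \<nu>"
      using \<nu>_pos speed_nonneg by (intro powr_mono2 K' that) auto
    also have "\<dots> = K' powr \<nu> * real n powr (\<nu> / (2 - \<nu>))"
      using \<open>K' > 0\<close> by (simp add: powr_mult powr_powr)
    finally have "4 * K * speed G S n powr \<nu> \<le> 4 * K * (K' powr \<nu> * real n powr (\<nu> / (2 - \<nu>)))"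
      using K_pos by (intro mult_left_mono) auto
    then show ?thesis using C[of n] by (simp add: mult_ac)
  qed
  then show ?thesis
    using \<open>C > 0\<close> \<open>K' > 0\<close> K_pos by (intro exI[of _ "4 * K * K' powr \<nu>"] exI[of _ C] conjI allI impI) auto
qed

lemma speed_exponent_le: "speed_exponent G S \<le> 1 / (2 - \<nu>)"
  unfolding speed_exponent_def
proof (rule sup_unit_le)
  fix c assume "c \<in> {c \<in> {0..1}. \<exists>K>0. \<forall>n\<ge>1. speed G S n \<ge> K * real n powr c}"
  then obtain A where A: "A > 0" "\<forall>n\<ge>1. A * real n powr c \<le> speed G S n" by auto
  obtain K' where K': "\<forall>n\<ge>1. speed G S n \<le> K' * real n powr (1 / (2 - \<nu>))"
    using speed_upper_bound by blast
  show "c \<le> 1 / (2 - \<nu>)"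
    by (rule powr_exponent_le[OF A(1), where B = K']) (use A K' order_trans in blast)
qed (use \<nu>_le_1 in simp)

lemma entropy_exponent_le:
  assumes "K' > 0" "L' > 0" and low: "\<forall>n\<ge>1. walk_entropy G S n \<ge> K' + L' * real n powr h"
  shows "h \<le> \<nu> / (2 - \<nu>)"
proof -
  obtain K2 L2 where K2: "K2 > 0" "L2 > 0"
    "\<forall>n\<ge>1. walk_entropy G S n \<le> L2 + K2 * real n powr (\<nu> / (2 - \<nu>))"
    using entropy_upper_bound by blast
  have "L' * real n powr h \<le> (L2 + K2) * real n powr (\<nu> / (2 - \<nu>))" if "n \<ge> 1" for n
  proof -
    have "1 \<le> real n powr (\<nu> / (2 - \<nu>))"
      using that \<nu>_pos \<nu>_le_1 by (intro ge_one_powr_ge_zero) auto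
    then have "L2 * 1 \<le> L2 * real n powr (\<nu> / (2 - \<nu>))" using K2 by (intro mult_left_mono) auto
    moreover have "K' + L' * real n powr h \<le> walk_entropy G S n"
      "walk_entropy G S n \<le> L2 + K2 * real n powr (\<nu> / (2 - \<nu>))" using low K2 that by auto
    ultimately show ?thesis using \<open>K' > 0\<close> unfolding distrib_right by linarith
  qed
  then show ?thesis using \<open>L' > 0\<close> by (intro powr_exponent_le[of L']) auto
qed

text \<open>
  For large \<open>n\<close> the constant \<open>C\<close> of \<open>entropy_le_speed\<close> is at most half of \<open>L' n\<^sup>h\<close>, which leaves
  \<open>(L n)\<^sup>\<nu> \<ge> L' / (8 K) * n\<^sup>h\<close>. The exponent \<open>h / \<nu>\<close> competes in the supremum only if it is at most \<open>1\<close>;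
  this is where the upper bound on the entropy enters.
\<close>
lemma speed_exponent_ge:
  assumes "K' > 0" "L' > 0" and low: "\<forall>n\<ge>1. walk_entropy G S n \<ge> K' + L' * real n powr h"
  shows "h \<le> speed_exponent G S * \<nu>"
proof (cases "h > 0")
  case False
  moreover have "0 \<le> speed_exponent G S * \<nu>" using speed_exponent_nonneg \<nu>_pos by simp
  ultimately show ?thesis by linarith
next
  case True
  obtain C where "C > 0" and C: "\<And>n. walk_entropy G S n \<le> C + 4 * K * speed G S n powr \<nu>"
    using entropy_le_speed by blast
  have "filterlim (\<lambda>n. L' * real n powr h) at_top sequentially"
    using True \<open>L' > 0\<close> by real_asymp
  then have "eventually (\<lambda>n. 2 * C \<le> L' * real n powr h) sequentially"
    by (auto simp: filterlim_at_top)
  then obtain N where N: "\<And>n. n \<ge> N \<Longrightarrow> 2 * C \<le> L' * real n powr h"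
    by (auto simp: eventually_sequentially)
  \<comment> \<open>8 K: half of the entropy bound is spent on C, and the factor of the speed is 4 K\<close>
  define c where "c = (L' / (8 * K)) powr (1 / \<nu>)"
  have "\<exists>c'>0. \<forall>n\<ge>1. c' * real n powr (h / \<nu>) \<le> speed G S n"
  proof (rule eventual_bound_imp_bound)
    show "0 < speed G S n" if "n \<ge> 1" for n
    proof (rule speed_pos)
      have "0 < K' + L' * real n powr h" using assms by (simp add: add_pos_nonneg)
      then show "0 < walk_entropy G S n" using low that by (meson less_le_trans)
    qed
    show "c > 0" using \<open>L' > 0\<close> K_pos by (simp add: c_def)
    show "c * real n powr (h / \<nu>) \<le> speed G S n" if n: "n \<ge> max N 1" for n
    proof -
      have "K' + L' * real n powr h \<le> C + 4 * K * speed G S n powr \<nu>"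
        using low C[of n] n by (meson max.boundedE order_trans)
      then have "L' * real n powr h \<le> 8 * K * speed G S n powr \<nu>"
        using N[of n] n \<open>K' > 0\<close> by simp
      then have "L' / (8 * K) * real n powr h \<le> speed G S n powr \<nu>"
        using K_pos by (simp add: field_simps)
      then have "(L' / (8 * K) * real n powr h) powr (1 / \<nu>) \<le> (speed G S n powr \<nu>) powr (1 / \<nu>)"
        using \<nu>_pos \<open>L' > 0\<close> K_pos by (intro powr_mono2) auto
      then show ?thesis
        using \<nu>_pos \<open>L' > 0\<close> K_pos speed_nonneg[of n]
        by (simp add: c_def powr_mult powr_powr powr_divide)
    qed
  qed simp
  moreover have "h / \<nu> \<le> 1"
  proof -
    have "h \<le> \<nu> / (2 - \<nu>)" using entropy_exponent_le[OF assms] .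
    also have "\<dots> \<le> \<nu> / 1" using \<nu>_pos \<nu>_le_1 by (intro divide_left_mono) auto
    finally show ?thesis using \<nu>_pos by simp
  qed
  ultimately have "h / \<nu> \<le> speed_exponent G S"
    unfolding speed_exponent_def using True \<nu>_pos by (intro sup_unit_ge) auto
  then show ?thesis using \<nu>_pos by (simp add: field_simps)
qed

end

section \<open>Random walks under equivariant maps to Hilbert spaces\<close>

context hilbert_space
begin

lemma smult_carrier: "x \<in> carrier B \<Longrightarrow> t \<odot>\<^bsub>B\<^esub> x \<in> carrier B"
  by (rule smult_closed) (simp_all add: real_ring_def)

lemma inner_zero_left: "z \<in> carrier B \<Longrightarrow> inner_prod B \<zero> z = 0"
  using inner_prod_add_left[of \<zero> \<zero> z] by simp

lemma inner_minus_left: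
  assumes "y \<in> carrier B" "z \<in> carrier B"
  shows "inner_prod B (\<ominus> y) z = - inner_prod B y z"
  using inner_prod_add_left[of y "\<ominus> y" z] inner_zero_left[of z] assms by (simp add: M.r_neg)

lemma hdist_sq:
  assumes "x \<in> carrier B" "y \<in> carrier B"
  shows "(hdist B x y)\<^sup>2 = inner_prod B x x - 2 * inner_prod B x y + inner_prod B y y"
proof -
  have right: "inner_prod B z (x \<oplus> \<ominus> y) = inner_prod B z x - inner_prod B z y"
    if "z \<in> carrier B" for z
    using that assms inner_prod_commute[of z "x \<oplus> \<ominus> y"] inner_prod_commute[of z x] inner_prod_commute[of z y]
    by (simp add: inner_prod_add_left inner_minus_left)
  have "(hdist B x y)\<^sup>2 = inner_prod B (x \<oplus> \<ominus> y) (x \<oplus> \<ominus> y)"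
    using assms inner_prod_nonneg[of "x \<oplus> \<ominus> y"] by (simp add: hdist_def hnorm_def a_minus_def)
  also have "\<dots> = inner_prod B x x - 2 * inner_prod B x y + inner_prod B y y"
    using assms inner_prod_commute[of x y] by (simp add: inner_prod_add_left inner_minus_left right)
  finally show ?thesis .
qed

lemma hdist_nonneg: "x \<in> carrier B \<Longrightarrow> y \<in> carrier B \<Longrightarrow> 0 \<le> hdist B x y"
  by (simp add: hdist_def hnorm_def inner_prod_nonneg)

lemma hdist_commute:
  assumes "x \<in> carrier B" "y \<in> carrier B"
  shows "hdist B x y = hdist B y x"
proof (rule power2_eq_imp_eq)
  show "(hdist B x y)\<^sup>2 = (hdist B y x)\<^sup>2"
    using assms inner_prod_commute[of x y] by (simp add: hdist_sq)
qed (use assms hdist_nonneg in auto)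

text \<open>
  The vector \<open>\<Sum>x. a x f(x)\<close> is only ever used through its inner products, so it is characterised by them;
  this replaces finite sums in the module.
\<close>
lemma ex_linear_combination:
  assumes "finite X" "\<And>x. x \<in> X \<Longrightarrow> f x \<in> carrier B"
  shows "\<exists>v\<in>carrier B. \<forall>z\<in>carrier B. inner_prod B v z = (\<Sum>x\<in>X. a x * inner_prod B (f x) z)"
  using assms
proof (induction X rule: finite_induct)
  case empty
  then show ?case using inner_zero_left by (intro bexI[of _ \<zero>]) auto
next
  case (insert x X)
  then obtain v where v: "v \<in> carrier B"
    "\<forall>z\<in>carrier B. inner_prod B v z = (\<Sum>x\<in>X. a x * inner_prod B (f x) z)" by auto
  show ?case
    using insert v smult_carrier[of "f x" "a x"]
    by (intro bexI[of _ "(a x \<odot>\<^bsub>B\<^esub> f x) \<oplus> v"])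
       (auto simp: inner_prod_add_left inner_prod_smult_left)
qed

text \<open>
  Expanding the squares, the terms that depend on one variable only vanish because the coefficients sum to
  zero, and what remains is \<open>- 2\<close> times the squared norm of \<open>\<Sum>x. a x f(x)\<close>.
\<close>
lemma squared_distance_negative_type:
  assumes fin: "finite X" and f: "\<And>x. x \<in> X \<Longrightarrow> f x \<in> carrier B" and "(\<Sum>x\<in>X. a x) = 0"
  shows "(\<Sum>x\<in>X. \<Sum>y\<in>X. a x * a y * (hdist B (f x) (f y))\<^sup>2) \<le> 0"
proof -
  define n where "n = (\<lambda>x. inner_prod B (f x) (f x))"
  obtain v where v: "v \<in> carrier B"
    and inner_v: "\<And>z. z \<in> carrier B \<Longrightarrow> inner_prod B v z = (\<Sum>x\<in>X. a x * inner_prod B (f x) z)"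
    using ex_linear_combination[where f = f and a = a, OF fin f] by auto
  have "inner_prod B v v = (\<Sum>x\<in>X. a x * inner_prod B (f x) v)" by (rule inner_v[OF v])
  also have "\<dots> = (\<Sum>x\<in>X. a x * (\<Sum>y\<in>X. a y * inner_prod B (f y) (f x)))"
  proof (intro sum.cong refl)
    fix x assume "x \<in> X"
    then have "inner_prod B (f x) v = inner_prod B v (f x)" using f v by (intro inner_prod_commute)
    also have "\<dots> = (\<Sum>y\<in>X. a y * inner_prod B (f y) (f x))" using f \<open>x \<in> X\<close> by (intro inner_v)
    finally show "a x * inner_prod B (f x) v = a x * (\<Sum>y\<in>X. a y * inner_prod B (f y) (f x))" by simp
  qed
  also have "\<dots> = (\<Sum>x\<in>X. \<Sum>y\<in>X. a x * a y * inner_prod B (f x) (f y))"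
  proof (intro sum.cong refl)
    fix x assume "x \<in> X"
    then have "(\<Sum>y\<in>X. a y * inner_prod B (f y) (f x)) = (\<Sum>y\<in>X. a y * inner_prod B (f x) (f y))"
      using f by (intro sum.cong refl arg_cong2[where f = "(*)"] inner_prod_commute)
    then show "a x * (\<Sum>y\<in>X. a y * inner_prod B (f y) (f x))
        = (\<Sum>y\<in>X. a x * a y * inner_prod B (f x) (f y))"
      by (simp add: sum_distrib_left mult.assoc)
  qed
  finally have v_sq: "inner_prod B v v = (\<Sum>x\<in>X. \<Sum>y\<in>X. a x * a y * inner_prod B (f x) (f y))" .
  have "(\<Sum>x\<in>X. \<Sum>y\<in>X. a x * a y * (hdist B (f x) (f y))\<^sup>2)
      = (\<Sum>x\<in>X. \<Sum>y\<in>X. (a x * n x) * a y + a x * (a y * n y) - 2 * (a x * a y * inner_prod B (f x) (f y)))"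
    using f by (intro sum.cong refl) (simp add: hdist_sq n_def algebra_simps)
  also have "\<dots> = (\<Sum>x\<in>X. a x * n x) * (\<Sum>y\<in>X. a y) + (\<Sum>x\<in>X. a x) * (\<Sum>y\<in>X. a y * n y)
      - 2 * inner_prod B v v"
    by (simp add: v_sq sum_product sum.distrib sum_subtractf sum_distrib_left[of 2])
  also have "\<dots> \<le> 0" using assms(3) inner_prod_nonneg[OF v] by simp
  finally show ?thesis .
qed

end

locale equivariant_embedding = marked_group G S + B: hilbert_space B
  for G :: "('a, 'm) monoid_scheme" (structure) and S and B :: "('b, 'k) inner_space_scheme" +
  fixes \<pi> :: "'a \<Rightarrow> 'b \<Rightarrow> 'b" and f :: "'a \<Rightarrow> 'b"
  assumes action: "\<pi> \<in> hom G (isometry_group B)"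
    and embedding: "equivariant_uniform_embedding G S B \<pi> f"
begin

lemma f_closed: "x \<in> carrier G \<Longrightarrow> f x \<in> carrier B"
  using embedding by (auto simp: equivariant_uniform_embedding_def)

lemma hdist_equivariant:
  assumes "x \<in> carrier G" "y \<in> carrier G"
  shows "hdist B (f x) (f y) = hdist B (f (inv x \<otimes> y)) (f \<one>)"
proof -
  have f_mult: "f (x \<otimes> z) = \<pi> x (f z)" if "z \<in> carrier G" for z
    using embedding assms that by (auto simp: equivariant_uniform_embedding_def)
  have "\<pi> x \<in> affine_isometries B"
    using action assms by (auto simp: hom_def isometry_group_def)
  then have isometry: "hdist B (\<pi> x u) (\<pi> x v) = hdist B u v" if "u \<in> carrier B" "v \<in> carrier B" for u v
    using that by (auto simp: affine_isometries_def)
  have "f x = \<pi> x (f \<one>)" using f_mult[of "\<one>"] assms by simp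
  moreover have "f y = \<pi> x (f (inv x \<otimes> y))"
    using f_mult[of "inv x \<otimes> y"] assms by (simp add: m_assoc[symmetric])
  ultimately have "hdist B (f x) (f y) = hdist B (f \<one>) (f (inv x \<otimes> y))"
    using assms f_closed isometry by simp
  also have "\<dots> = hdist B (f (inv x \<otimes> y)) (f \<one>)"
    using assms f_closed by (intro B.hdist_commute) auto
  finally show ?thesis .
qed

definition displacement :: "'a \<Rightarrow> real" where
  "displacement x = (hdist B (f x) (f \<one>))\<^sup>2"

definition mean_displacement :: "nat \<Rightarrow> real" where
  "mean_displacement n = measure_pmf.expectation (walk n) displacement"

text \<open>
  \<open>X (i + j)\<close> is a product of independent copies of \<open>X i\<close> and \<open>X j\<close>. The law of \<open>X i\<close> is symmetric, so
  the first factor may be inverted, and equivariance turns the displacement of \<open>x\<^sup>-\<^sup>1 y\<close> into a distance.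
\<close>
lemma mean_displacement_add:
  assumes "i \<le> N" "j \<le> N"
  shows "mean_displacement (i + j)
    = (\<Sum>x\<in>ball N. \<Sum>y\<in>ball N. pmf (walk i) x * pmf (walk j) y * (hdist B (f x) (f y))\<^sup>2)"
proof -
  have "mean_displacement (i + j)
      = (\<Sum>x\<in>ball N. \<Sum>y\<in>ball N. pmf (walk i) x * pmf (walk j) y * displacement (x \<otimes> y))"
    unfolding mean_displacement_def walk_add
    by (rule expectation_convolution) (use assms in \<open>auto intro: subsetD[OF set_walk_ball]\<close>)
  also have "\<dots> = (\<Sum>x\<in>ball N. \<Sum>y\<in>ball N. pmf (walk i) x * pmf (walk j) y
      * displacement (inv x \<otimes> y))"
  proof (rule sum.reindex_bij_witness[where i = "\<lambda>x. inv x" and j = "\<lambda>x. inv x"])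
  qed (auto simp: mem_ball pmf_walk_inv)
  also have "\<dots> = (\<Sum>x\<in>ball N. \<Sum>y\<in>ball N. pmf (walk i) x * pmf (walk j) y * (hdist B (f x) (f y))\<^sup>2)"
  proof (intro sum.cong refl)
    fix x y assume "x \<in> ball N" "y \<in> ball N"
    then have "displacement (inv x \<otimes> y) = (hdist B (f x) (f y))\<^sup>2"
      unfolding displacement_def by (subst hdist_equivariant[of x y]) (auto simp: mem_ball)
    then show "pmf (walk i) x * pmf (walk j) y * displacement (inv x \<otimes> y)
        = pmf (walk i) x * pmf (walk j) y * (hdist B (f x) (f y))\<^sup>2" by simp
  qed
  finally show ?thesis .
qed

text \<open>
  The second difference at even times is the quadratic form of the kernel \<open>\<parallel>f x - f y\<parallel>\<^sup>2\<close> at the signed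
  measure \<open>p - r\<close> of total mass zero, where \<open>p\<close> and \<open>r\<close> are the laws of \<open>X m\<close> and \<open>X (m + 2)\<close>.
\<close>
lemma mean_displacement_concave:
  "mean_displacement (2 * m) - 2 * mean_displacement (2 * Suc m) + mean_displacement (2 * Suc (Suc m)) \<le> 0"
proof -
  define N where "N = m + 2"
  define p where "p = pmf (walk m)"
  define r where "r = pmf (walk (m + 2))"
  define D where "D = (\<lambda>x y. (hdist B (f x) (f y))\<^sup>2)"
  have "(\<Sum>x\<in>ball N. \<Sum>y\<in>ball N. (p x - r x) * (p y - r y) * D x y) \<le> 0"
    unfolding D_def
  proof (rule B.squared_distance_negative_type)
    have "(\<Sum>x\<in>ball N. p x) = 1" "(\<Sum>x\<in>ball N. r x) = 1"
      unfolding p_def r_def by (rule sum_pmf_walk, simp add: N_def)+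
    then show "(\<Sum>x\<in>ball N. p x - r x) = 0" by (simp add: sum_subtractf)
  qed (auto simp: mem_ball f_closed)
  also have "(\<Sum>x\<in>ball N. \<Sum>y\<in>ball N. (p x - r x) * (p y - r y) * D x y)
      = (\<Sum>x\<in>ball N. \<Sum>y\<in>ball N. p x * p y * D x y) - (\<Sum>x\<in>ball N. \<Sum>y\<in>ball N. p x * r y * D x y)
      - (\<Sum>x\<in>ball N. \<Sum>y\<in>ball N. r x * p y * D x y) + (\<Sum>x\<in>ball N. \<Sum>y\<in>ball N. r x * r y * D x y)"
  proof -
    have "(p x - r x) * (p y - r y) * D x y
        = p x * p y * D x y - p x * r y * D x y - r x * p y * D x y + r x * r y * D x y" for x y
      by (simp add: algebra_simps)
    then show ?thesis by (simp only: sum.distrib sum_subtractf)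
  qed
  also have "\<dots> = mean_displacement (m + m) - mean_displacement (m + (m + 2))
      - mean_displacement ((m + 2) + m) + mean_displacement ((m + 2) + (m + 2))"
  proof -
    have "m \<le> N" "m + 2 \<le> N" by (simp_all add: N_def)
    note add = mean_displacement_add[OF this(1) this(1)] mean_displacement_add[OF this(1) this(2)]
      mean_displacement_add[OF this(2) this(1)] mean_displacement_add[OF this(2) this(2)]
    show ?thesis unfolding add p_def r_def D_def ..
  qed
  finally have "mean_displacement (m + m) - mean_displacement (m + (m + 2))
      - mean_displacement ((m + 2) + m) + mean_displacement ((m + 2) + (m + 2)) \<le> 0" .
  moreover have "m + m = 2 * m" "m + (m + 2) = 2 * Suc m" "(m + 2) + m = 2 * Suc m"
    "(m + 2) + (m + 2) = 2 * Suc (Suc m)" by simp_all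
  ultimately show ?thesis by (simp only:)
qed

lemma mean_displacement_linear: "mean_displacement (2 * m) \<le> real m * mean_displacement 2"
proof -
  define E where "E = (\<lambda>m. mean_displacement (2 * m))"
  have zero: "E 0 = 0"
    using f_closed[of "\<one>"] by (simp add: E_def mean_displacement_def displacement_def B.hdist_sq)
  have increment: "E (Suc m) - E m \<le> E 1" for m
  proof (induction m)
    case (Suc m)
    have "E m - 2 * E (Suc m) + E (Suc (Suc m)) \<le> 0"
      unfolding E_def by (rule mean_displacement_concave)
    then show ?case using Suc by linarith
  qed (simp add: zero)
  have "E m \<le> real m * E 1"
  proof (induction m)
    case (Suc m)
    then show ?case using increment[of m] by (simp add: algebra_simps)
  qed (simp add: zero)
  then show ?thesis by (simp add: E_def)
qed

lemma moment_le_mean_displacement: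
  assumes "compression_function G S B f \<rho>" "\<And>n::nat. n \<ge> 1 \<Longrightarrow> \<rho> (real n) \<ge> A * real n powr c" "A > 0"
  shows "A\<^sup>2 * moment n (2 * c) \<le> mean_displacement n"
proof -
  have pointwise: "A\<^sup>2 * real (len x) powr (2 * c) \<le> displacement x" if x: "x \<in> carrier G" for x
  proof (cases "len x = 0")
    case False
    have "A * real (len x) powr c \<le> \<rho> (real (len x))" using False by (intro assms) simp
    also have "\<dots> \<le> hdist B (f x) (f \<one>)"
    proof -
      have "\<forall>x\<in>carrier G. \<forall>y\<in>carrier G. \<rho> (real (len (inv y \<otimes> x))) \<le> hdist B (f x) (f y)"
        using assms(1) by (simp add: compression_function_def)
      from this[rule_format, OF x one_closed] show ?thesis using x by simp
    qed
    finally have "(A * real (len x) powr c)\<^sup>2 \<le> displacement x"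
      unfolding displacement_def using assms(3) by (intro power_mono) auto
    also have "(A * real (len x) powr c)\<^sup>2 = A\<^sup>2 * real (len x) powr (2 * c)"
      using False by (simp add: power_mult_distrib powr_power mult.commute)
    finally show ?thesis .
  qed (simp add: displacement_def)
  have "A\<^sup>2 * moment n (2 * c) = (\<Sum>x\<in>ball n. pmf (walk n) x * (A\<^sup>2 * real (len x) powr (2 * c)))"
    by (simp add: moment_def sum_distrib_left mult_ac)
  also have "\<dots> \<le> (\<Sum>x\<in>ball n. pmf (walk n) x * displacement x)"
    by (intro sum_mono mult_left_mono pointwise) (auto simp: mem_ball)
  also have "\<dots> = mean_displacement n" by (simp add: mean_displacement_def walk_expectation[OF order_refl])
  finally show ?thesis .
qed

end

lemma compression_exponent_in_unit: "compression_exponent G S B f \<in> {0..1}"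
  unfolding compression_exponent_def by (rule sup_unit_in_unit) auto

context stretched_growth
begin

text \<open>
  If \<open>\<nu> \<le> 2 c\<close>, the moment of order \<open>\<nu>\<close> is bounded by a power of the moment of order \<open>2 c\<close>, which is
  linear in time. If \<open>2 c < \<nu>\<close>, the bound \<open>h \<le> \<nu> / (2 - \<nu>) \<le> 1\<close> already suffices.
\<close>
lemma entropy_exponent_compression_le:
  assumes emb: "hilbert_space B" "\<pi> \<in> hom G (isometry_group B)" "equivariant_uniform_embedding G S B \<pi> f"
    and comp: "compression_function G S B f \<rho>" "\<And>n::nat. n \<ge> 1 \<Longrightarrow> \<rho> (real n) \<ge> A * real n powr c"
      "A > 0" "c \<ge> 0"
    and ent: "K' > 0" "L' > 0" "\<forall>n\<ge>1. walk_entropy G S n \<ge> K' + L' * real n powr h" "h > 0"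
  shows "2 * h * c \<le> \<nu>"
proof -
  interpret E: equivariant_embedding G S B \<pi> f
    using emb by (intro equivariant_embedding.intro equivariant_embedding_axioms.intro marked_group_axioms)
  show ?thesis
  proof (cases "\<nu> \<le> 2 * c")
    case False
    have "h \<le> \<nu> / (2 - \<nu>)" using ent(1-3) by (rule entropy_exponent_le)
    also have "\<dots> \<le> 1" using \<nu>_le_1 by simp
    finally have "2 * h * c \<le> 2 * 1 * c" using comp(4) by (intro mult_right_mono) auto
    then show ?thesis using False by simp
  next
    case True
    define \<theta> where "\<theta> = \<nu> / (2 * c)"
    have "c > 0" using True \<nu>_pos by simp
    then have "\<theta> > 0" using \<nu>_pos by (simp add: \<theta>_def)
    obtain C where "C > 0" and C: "\<And>n. walk_entropy G S n \<le> C + 2 * K * moment n \<nu>"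
      using entropy_le_moment by blast
    define M where "M = E.mean_displacement 2 / A\<^sup>2"
    have M: "moment (2 * m) (2 * c) \<le> M * real m" for m
    proof -
      have "A\<^sup>2 * moment (2 * m) (2 * c) \<le> real m * E.mean_displacement 2"
        using E.moment_le_mean_displacement[OF comp(1-3)] E.mean_displacement_linear[of m] by (meson order_trans)
      then show ?thesis using \<open>A > 0\<close> by (simp add: M_def field_simps)
    qed
    have moment_nonneg: "0 \<le> moment n \<theta>'" for n \<theta>' by (simp add: moment_def sum_nonneg)
    have "0 \<le> M" using M[of 1] moment_nonneg[of 2 "2 * c"] by simp
    have "L' * real m powr h \<le> (C + 4 * K * M powr \<theta>) * real m powr \<theta>" if m: "m \<ge> 1" for m
    proof -
      have "K' + L' * real (2 * m) powr h \<le> walk_entropy G S (2 * m)"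
        using ent(3)[rule_format, of "2 * m"] m by simp
      moreover have "L' * real m powr h \<le> L' * real (2 * m) powr h"
        using ent by (intro mult_left_mono powr_mono2) auto
      moreover have "walk_entropy G S (2 * m) \<le> C + 2 * K * moment (2 * m) \<nu>" by (rule C)
      moreover have "2 * K * moment (2 * m) \<nu> \<le> 2 * K * (2 * (M powr \<theta> * real m powr \<theta>))"
      proof (intro mult_left_mono)
        have "moment (2 * m) \<nu> \<le> 2 * moment (2 * m) (2 * c) powr \<theta>"
          unfolding \<theta>_def using \<nu>_pos True by (rule moment_le)
        also have "moment (2 * m) (2 * c) powr \<theta> \<le> (M * real m) powr \<theta>"
          using \<open>\<theta> > 0\<close> by (intro powr_mono2 M moment_nonneg) auto
        also have "(M * real m) powr \<theta> = M powr \<theta> * real m powr \<theta>"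
          using \<open>0 \<le> M\<close> by (simp add: powr_mult)
        finally show "moment (2 * m) \<nu> \<le> 2 * (M powr \<theta> * real m powr \<theta>)" by simp
      qed (use K_pos in simp)
      moreover have "C * 1 \<le> C * real m powr \<theta>"
        using \<open>C > 0\<close> \<open>\<theta> > 0\<close> m by (intro mult_left_mono ge_one_powr_ge_zero) auto
      ultimately show ?thesis using ent(1) by (simp add: algebra_simps)
    qed
    then have "h \<le> \<theta>" using ent(2) by (intro powr_exponent_le[of L']) auto
    then show ?thesis using \<open>c > 0\<close> by (simp add: \<theta>_def field_simps)
  qed
qed

lemma entropy_exponent_equivariant_compression_le:
  assumes ent: "K' > 0" "L' > 0" "\<forall>n\<ge>1. walk_entropy G S n \<ge> K' + L' * real n powr h"
  shows "2 * h * equivariant_compression_exponent TYPE('u) G S \<le> \<nu>"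
proof -
  let ?X = "{compression_exponent G S B f |
                 (B :: ((nat \<Rightarrow> real) \<times> 'u) inner_space) \<pi> f.
                 hilbert_space B \<and> \<pi> \<in> hom G (isometry_group B) \<and>
                 equivariant_uniform_embedding G S B \<pi> f}"
  show ?thesis
  proof (cases "h > 0")
    case True
    have "equivariant_compression_exponent TYPE('u) G S \<le> \<nu> / (2 * h)"
      unfolding equivariant_compression_exponent_def
    proof (rule sup_unit_le)
      fix c assume "c \<in> ?X"
      then obtain B :: "((nat \<Rightarrow> real) \<times> 'u) inner_space" and \<pi> f where
        emb: "hilbert_space B" "\<pi> \<in> hom G (isometry_group B)" "equivariant_uniform_embedding G S B \<pi> f"
        and c: "c = compression_exponent G S B f" by blast
      show "c \<le> \<nu> / (2 * h)"
        unfolding c compression_exponent_def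
      proof (rule sup_unit_le)
        fix c' assume "c' \<in> {c \<in> {0..1}. \<exists>K>0. \<exists>\<rho>. compression_function G S B f \<rho> \<and>
                             (\<forall>n::nat. n \<ge> 1 \<longrightarrow> \<rho> (real n) \<ge> K * real n powr c)}"
        then obtain A \<rho> where "A > 0" "compression_function G S B f \<rho>" "c' \<ge> 0"
          "\<And>n::nat. n \<ge> 1 \<Longrightarrow> \<rho> (real n) \<ge> A * real n powr c'" by auto
        then have "2 * h * c' \<le> \<nu>"
          using entropy_exponent_compression_le[OF emb] ent True by blast
        then show "c' \<le> \<nu> / (2 * h)" using True by (simp add: field_simps)
      qed (use True \<nu>_pos in simp)
    qed (use True \<nu>_pos in simp)
    then show ?thesis using True by (simp add: field_simps)
  next
    case False
    have "?X \<subseteq> {0..1}" using compression_exponent_in_unit by blast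
    then have "0 \<le> equivariant_compression_exponent TYPE('u) G S"
      unfolding equivariant_compression_exponent_def by (rule sup_unit_nonneg)
    then have "2 * h * equivariant_compression_exponent TYPE('u) G S \<le> 0"
      using False by (simp add: mult_nonpos_nonneg)
    then show ?thesis using \<nu>_pos by simp
  qed
qed

end

section \<open>The Hilbert space of square summable sequences\<close>

definition ell2 :: "(nat \<Rightarrow> real) set" where
  "ell2 = {x. summable (\<lambda>i. (x i)\<^sup>2)}"

definition ell2_norm :: "(nat \<Rightarrow> real) \<Rightarrow> real" where
  "ell2_norm x = sqrt (\<Sum>i. (x i)\<^sup>2)"

lemma ell2_bounded:
  assumes "\<And>n. (\<Sum>i<n. (x i)\<^sup>2) \<le> C"
  shows "x \<in> ell2" "(\<Sum>i. (x i)\<^sup>2) \<le> C"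
proof -
  show "x \<in> ell2"
    unfolding ell2_def using assms by (auto intro!: summableI_nonneg_bounded[where x = C])
  then show "(\<Sum>i. (x i)\<^sup>2) \<le> C"
    unfolding ell2_def using assms by (auto intro: suminf_le_const)
qed

lemma ell2_sum_le: "x \<in> ell2 \<Longrightarrow> finite I \<Longrightarrow> (\<Sum>i\<in>I. (x i)\<^sup>2) \<le> (ell2_norm x)\<^sup>2"
  unfolding ell2_norm_def by (subst real_sqrt_pow2) (auto simp: ell2_def intro!: suminf_nonneg sum_le_suminf)

lemma L2_set_le_ell2_norm: "x \<in> ell2 \<Longrightarrow> L2_set x {..<n} \<le> ell2_norm x"
  unfolding L2_set_def ell2_norm_def by (auto simp: ell2_def intro!: real_sqrt_le_mono sum_le_suminf)

lemma abs_le_ell2_norm: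
  assumes "x \<in> ell2"
  shows "\<bar>x i\<bar> \<le> ell2_norm x"
proof -
  have "\<bar>x i\<bar> \<le> L2_set (\<lambda>i. \<bar>x i\<bar>) {..<Suc i}" by (rule member_le_L2_set) auto
  also have "\<dots> = L2_set x {..<Suc i}" by (simp add: L2_set_def)
  also have "\<dots> \<le> ell2_norm x" by (rule L2_set_le_ell2_norm[OF assms])
  finally show ?thesis .
qed

lemma ell2_bounded_L2_set:
  assumes "\<And>n. L2_set x {..<n} \<le> C"
  shows "x \<in> ell2" "ell2_norm x \<le> C"
proof -
  have "0 \<le> C" using assms[of 0] by simp
  have "(\<Sum>i<n. (x i)\<^sup>2) \<le> C\<^sup>2" for n
    by (rule sqrt_le_D) (use assms[of n] in \<open>simp add: L2_set_def\<close>)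
  note bounded = ell2_bounded[OF this]
  show "x \<in> ell2" by (rule bounded(1))
  show "ell2_norm x \<le> C"
    unfolding ell2_norm_def using bounded(2) \<open>0 \<le> C\<close> by (rule real_le_lsqrt[rotated])
qed

lemma ell2_triangle:
  assumes "x \<in> ell2" "y \<in> ell2"
  shows "(\<lambda>i. x i + y i) \<in> ell2" "ell2_norm (\<lambda>i. x i + y i) \<le> ell2_norm x + ell2_norm y"
proof -
  have "L2_set (\<lambda>i. x i + y i) {..<n} \<le> ell2_norm x + ell2_norm y" for n
    using L2_set_triangle_ineq[of x y "{..<n}"] L2_set_le_ell2_norm[OF assms(1), of n]
      L2_set_le_ell2_norm[OF assms(2), of n] by linarith
  from ell2_bounded_L2_set[OF this]
  show "(\<lambda>i. x i + y i) \<in> ell2" "ell2_norm (\<lambda>i. x i + y i) \<le> ell2_norm x + ell2_norm y" by auto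
qed

lemma ell2_scale: "x \<in> ell2 \<Longrightarrow> (\<lambda>i. t * x i) \<in> ell2"
  by (auto simp: ell2_def power_mult_distrib intro: summable_mult)

lemma ell2_uminus: "x \<in> ell2 \<Longrightarrow> (\<lambda>i. - x i) \<in> ell2"
  by (simp add: ell2_def)

lemma ell2_diff: "x \<in> ell2 \<Longrightarrow> y \<in> ell2 \<Longrightarrow> (\<lambda>i. x i - y i) \<in> ell2"
  using ell2_triangle(1)[of x "\<lambda>i. - y i"] ell2_uminus by simp

lemma ell2_zero: "(\<lambda>i. 0) \<in> ell2"
  by (simp add: ell2_def)

lemma ell2_product_summable:
  assumes "x \<in> ell2" "y \<in> ell2"
  shows "summable (\<lambda>i. x i * y i)"
proof (rule summable_comparison_test')
  show "summable (\<lambda>i. (x i)\<^sup>2 + (y i)\<^sup>2)"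
    using assms by (intro summable_add) (auto simp: ell2_def)
  show "norm (x i * y i) \<le> (x i)\<^sup>2 + (y i)\<^sup>2" for i
  proof -
    have "2 * (\<bar>x i\<bar> * \<bar>y i\<bar>) \<le> (x i)\<^sup>2 + (y i)\<^sup>2"
      using sum_squares_bound[of "\<bar>x i\<bar>" "\<bar>y i\<bar>"] by simp
    moreover have "0 \<le> \<bar>x i\<bar> * \<bar>y i\<bar>" by simp
    ultimately show ?thesis unfolding real_norm_def abs_mult by linarith
  qed
qed

text \<open>
  The limit is taken coordinatewise; a bound on \<open>x m - x n\<close> over finite segments survives the limit in \<open>n\<close>
  and is uniform in the segment.
\<close>
lemma ell2_complete:
  fixes x :: "nat \<Rightarrow> nat \<Rightarrow> real"
  assumes x: "\<And>n. x n \<in> ell2"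
    and Cauchy: "\<And>e. e > 0 \<Longrightarrow> \<exists>N. \<forall>m\<ge>N. \<forall>n\<ge>N. ell2_norm (\<lambda>i. x m i - x n i) < e"
  shows "\<exists>y\<in>ell2. \<forall>e>0. \<exists>N. \<forall>n\<ge>N. ell2_norm (\<lambda>i. x n i - y i) < e"
proof -
  have "Cauchy (\<lambda>n. x n i)" for i
  proof (rule CauchyI)
    fix e :: real assume "e > 0"
    then obtain N where "\<forall>m\<ge>N. \<forall>n\<ge>N. ell2_norm (\<lambda>i. x m i - x n i) < e" using Cauchy by blast
    moreover have "norm (x m i - x n i) \<le> ell2_norm (\<lambda>i. x m i - x n i)" for m n
      using abs_le_ell2_norm[OF ell2_diff[OF x[of m] x[of n]], of i] by simp
    ultimately show "\<exists>N. \<forall>m\<ge>N. \<forall>n\<ge>N. norm (x m i - x n i) < e"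
      by (meson order_le_less_trans)
  qed
  then have "\<exists>y. \<forall>i. (\<lambda>n. x n i) \<longlonglongrightarrow> y i"
    by (intro choice) (auto simp: Cauchy_convergent_iff convergent_def)
  then obtain y where y: "\<And>i. (\<lambda>n. x n i) \<longlonglongrightarrow> y i" by blast
  have close: "(\<lambda>i. x m i - y i) \<in> ell2 \<and> ell2_norm (\<lambda>i. x m i - y i) \<le> e"
    if N: "\<forall>m\<ge>N. \<forall>n\<ge>N. ell2_norm (\<lambda>i. x m i - x n i) < e" and "m \<ge> N" for N m e
  proof -
    have "L2_set (\<lambda>i. x m i - y i) {..<k} \<le> e" for k
    proof (rule LIMSEQ_le_const2)
      show "(\<lambda>n. L2_set (\<lambda>i. x m i - x n i) {..<k}) \<longlonglongrightarrow> L2_set (\<lambda>i. x m i - y i) {..<k}"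
        unfolding L2_set_def by (intro tendsto_intros y)
      have "L2_set (\<lambda>i. x m i - x n i) {..<k} \<le> e" if "n \<ge> N" for n
        using L2_set_le_ell2_norm[OF ell2_diff[OF x[of m] x[of n]], of k] N \<open>m \<ge> N\<close> that
        by (meson less_imp_le order_trans)
      then show "\<exists>N. \<forall>n\<ge>N. L2_set (\<lambda>i. x m i - x n i) {..<k} \<le> e" by blast
    qed
    from ell2_bounded_L2_set[OF this] show ?thesis by blast
  qed
  obtain N where "\<forall>m\<ge>N. \<forall>n\<ge>N. ell2_norm (\<lambda>i. x m i - x n i) < 1" using Cauchy[of 1] by auto
  then have "(\<lambda>i. x N i - y i) \<in> ell2" using close by blast
  from ell2_diff[OF x[of N] this] have "y \<in> ell2" by simp
  moreover have "\<exists>N. \<forall>n\<ge>N. ell2_norm (\<lambda>i. x n i - y i) < e" if "e > 0" for e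
  proof -
    from that have "e / 2 > 0" by simp
    from Cauchy[OF this] obtain N where "\<forall>m\<ge>N. \<forall>n\<ge>N. ell2_norm (\<lambda>i. x m i - x n i) < e / 2"
      by blast
    then have "ell2_norm (\<lambda>i. x n i - y i) \<le> e / 2" if "n \<ge> N" for n using close that by blast
    then show ?thesis using \<open>e > 0\<close> by (intro exI[of _ N] allI impI) (rule order_le_less_trans[of _ "e / 2"], auto)
  qed
  ultimately show ?thesis by blast
qed

text \<open>
  A retraction of the whole type onto square summable sequences. The axioms of \<^locale>\<open>Metric_space\<close> ask for a
  symmetric non-negative distance at all arguments, also outside the carrier. Addition in the space below
  first applies this retraction, which makes the distance a pseudometric on the whole type.
\<close>
definition ell2_part :: "(nat \<Rightarrow> real) \<times> 'u \<Rightarrow> nat \<Rightarrow> real" where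
  "ell2_part x = (if fst x \<in> ell2 then fst x else (\<lambda>_. 0))"

definition ell2_space :: "((nat \<Rightarrow> real) \<times> 'u) inner_space" where
  "ell2_space = \<lparr>carrier = ell2 \<times> {undefined}, mult = (\<lambda>_ _. undefined), one = undefined,
     zero = (\<lambda>_. 0, undefined), add = (\<lambda>x y. (\<lambda>i. ell2_part x i + ell2_part y i, undefined)),
     smult = (\<lambda>t x. (\<lambda>i. t * fst x i, undefined)), inner_prod = (\<lambda>x y. \<Sum>i. fst x i * fst y i)\<rparr>"

lemma ell2_space_simps [simp]:
  "carrier ell2_space = ell2 \<times> {undefined}"
  "\<zero>\<^bsub>ell2_space\<^esub> = (\<lambda>_. 0, undefined)"
  "x \<oplus>\<^bsub>ell2_space\<^esub> y = (\<lambda>i. ell2_part x i + ell2_part y i, undefined)"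
  "t \<odot>\<^bsub>ell2_space\<^esub> x = (\<lambda>i. t * fst x i, undefined)"
  "inner_prod ell2_space x y = (\<Sum>i. fst x i * fst y i)"
  by (simp_all add: ell2_space_def)

lemma ell2_part_in_ell2 [simp]: "ell2_part x \<in> ell2"
  by (simp add: ell2_part_def ell2_zero)

lemma ell2_part_id [simp]: "v \<in> ell2 \<Longrightarrow> ell2_part (v, u) = v"
  by (simp add: ell2_part_def)

lemma cring_real_ring: "cring real_ring"
proof (rule cringI)
  show "abelian_group real_ring"
  proof (rule abelian_groupI)
    fix x assume "x \<in> carrier real_ring"
    show "\<exists>y\<in>carrier real_ring. y \<oplus>\<^bsub>real_ring\<^esub> x = \<zero>\<^bsub>real_ring\<^esub>"
      by (rule bexI[of _ "- x"]) (auto simp: real_ring_def)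
  qed (auto simp: real_ring_def)
  show "comm_monoid real_ring"
    by (rule comm_monoidI) (auto simp: real_ring_def)
qed (auto simp: real_ring_def algebra_simps)

lemma abelian_group_ell2_space: "abelian_group (ell2_space :: ((nat \<Rightarrow> real) \<times> 'u) inner_space)"
proof (rule abelian_groupI)
  fix x :: "(nat \<Rightarrow> real) \<times> 'u" assume "x \<in> carrier ell2_space"
  then show "\<exists>y\<in>carrier ell2_space. y \<oplus>\<^bsub>ell2_space\<^esub> x = \<zero>\<^bsub>ell2_space\<^esub>"
    using ell2_uminus by (intro bexI[of _ "(\<lambda>i. - fst x i, undefined)"]) auto
qed (auto simp: ell2_triangle(1) ell2_zero add_ac)

lemma ell2_space_minus:
  fixes x y :: "(nat \<Rightarrow> real) \<times> 'u"
  shows "x \<ominus>\<^bsub>ell2_space\<^esub> y = (\<lambda>i. ell2_part x i - ell2_part y i, undefined)"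
proof -
  have "\<ominus>\<^bsub>ell2_space\<^esub> y = (\<lambda>i. - ell2_part y i, undefined)"
    unfolding a_inv_def m_inv_def
  proof (rule the_equality)
    fix z assume "z \<in> carrier (add_monoid ell2_space) \<and>
      y \<otimes>\<^bsub>add_monoid ell2_space\<^esub> z = \<one>\<^bsub>add_monoid ell2_space\<^esub> \<and>
      z \<otimes>\<^bsub>add_monoid ell2_space\<^esub> y = \<one>\<^bsub>add_monoid ell2_space\<^esub>"
    then show "z = (\<lambda>i. - ell2_part y i, undefined)"
      by (auto simp: fun_eq_iff eq_neg_iff_add_eq_0)
  qed (auto simp: ell2_uminus)
  then show ?thesis by (simp add: a_minus_def ell2_uminus)
qed

lemma hdist_ell2_space:
  "hdist ell2_space x y = ell2_norm (\<lambda>i. ell2_part x i - ell2_part y i)"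
  unfolding hdist_def ell2_space_minus hnorm_def ell2_norm_def by (simp add: power2_eq_square)

lemma ell2_norm_commute: "ell2_norm (\<lambda>i. x i - y i) = ell2_norm (\<lambda>i. y i - x i)"
  by (simp add: ell2_norm_def power2_commute)

lemma ell2_norm_nonneg: "x \<in> ell2 \<Longrightarrow> 0 \<le> ell2_norm x"
  by (simp add: ell2_norm_def ell2_def suminf_nonneg)

lemma ell2_norm_eq_0_iff:
  assumes "x \<in> ell2"
  shows "ell2_norm x = 0 \<longleftrightarrow> x = (\<lambda>_. 0)"
proof
  assume "ell2_norm x = 0"
  then have "\<bar>x i\<bar> \<le> 0" for i using abs_le_ell2_norm[OF assms, of i] by simp
  then show "x = (\<lambda>_. 0)" by (simp add: fun_eq_iff)
qed (simp add: ell2_norm_def)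

lemma Metric_space_ell2_space:
  "Metric_space (carrier (ell2_space :: ((nat \<Rightarrow> real) \<times> 'u) inner_space)) (hdist ell2_space)"
proof
  fix x y z :: "(nat \<Rightarrow> real) \<times> 'u"
  show "0 \<le> hdist ell2_space x y"
    unfolding hdist_ell2_space by (intro ell2_norm_nonneg ell2_diff) auto
  show "hdist ell2_space x y = hdist ell2_space y x"
    unfolding hdist_ell2_space by (rule ell2_norm_commute)
  assume x: "x \<in> carrier ell2_space" and y: "y \<in> carrier ell2_space"
  have "hdist ell2_space x y = 0 \<longleftrightarrow> (\<lambda>i. ell2_part x i - ell2_part y i) = (\<lambda>_. 0)"
    unfolding hdist_ell2_space by (intro ell2_norm_eq_0_iff ell2_diff) auto
  also have "\<dots> \<longleftrightarrow> x = y" using x y by (auto simp: fun_eq_iff)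
  finally show "hdist ell2_space x y = 0 \<longleftrightarrow> x = y" .
  show "hdist ell2_space x z \<le> hdist ell2_space x y + hdist ell2_space y z"
    using ell2_triangle(2)[of "\<lambda>i. ell2_part x i - ell2_part y i" "\<lambda>i. ell2_part y i - ell2_part z i"]
    by (simp add: hdist_ell2_space ell2_diff)
qed

lemma hilbert_space_ell2_space: "hilbert_space (ell2_space :: ((nat \<Rightarrow> real) \<times> 'u) inner_space)"
proof -
  let ?B = "ell2_space :: ((nat \<Rightarrow> real) \<times> 'u) inner_space"
  have "Module.module real_ring ?B"
    by (rule moduleI[OF cring_real_ring abelian_group_ell2_space])
       (auto simp: real_ring_def ell2_scale algebra_simps)
  moreover have "hilbert_space_axioms ?B"
  proof
    show "inner_prod ?B x y = inner_prod ?B y x" for x y by (simp add: mult.commute)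
    show "inner_prod ?B (x \<oplus>\<^bsub>?B\<^esub> y) z = inner_prod ?B x z + inner_prod ?B y z"
      if "x \<in> carrier ?B" "y \<in> carrier ?B" "z \<in> carrier ?B" for x y z
      using that by (auto simp: distrib_right suminf_add ell2_product_summable)
    show "inner_prod ?B (t \<odot>\<^bsub>?B\<^esub> x) y = t * inner_prod ?B x y"
      if "x \<in> carrier ?B" "y \<in> carrier ?B" for x y t
      using that by (auto simp: mult.assoc suminf_mult ell2_product_summable)
    show "0 \<le> inner_prod ?B x x" if "x \<in> carrier ?B" for x
      using that by (auto intro!: suminf_nonneg ell2_product_summable)
    show "x = \<zero>\<^bsub>?B\<^esub>" if "x \<in> carrier ?B" "inner_prod ?B x x = 0" for x
      using that ell2_norm_eq_0_iff[of "fst x"] by (auto simp: ell2_norm_def power2_eq_square)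
    interpret M: Metric_space "carrier ?B" "hdist ?B" by (rule Metric_space_ell2_space)
    show "M.mcomplete"
      unfolding M.mcomplete_def
    proof (intro allI impI)
      fix \<sigma> assume "M.MCauchy \<sigma>"
      then have \<sigma>: "\<And>n. \<sigma> n \<in> carrier ?B"
        and Cauchy: "\<And>e. e > 0 \<Longrightarrow> \<exists>N. \<forall>n n'. N \<le> n \<longrightarrow> N \<le> n' \<longrightarrow> hdist ?B (\<sigma> n) (\<sigma> n') < e"
        unfolding M.MCauchy_def by blast+
      define x where "x = (\<lambda>n. fst (\<sigma> n))"
      have x: "x n \<in> ell2" "ell2_part (\<sigma> n) = x n" for n using \<sigma>[of n] by (auto simp: x_def)
      have "\<exists>y\<in>ell2. \<forall>e>0. \<exists>N. \<forall>n\<ge>N. ell2_norm (\<lambda>i. x n i - y i) < e"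
        using Cauchy by (intro ell2_complete x(1)) (auto simp: hdist_ell2_space x(2))
      then obtain y where "y \<in> ell2" "\<forall>e>0. \<exists>N. \<forall>n\<ge>N. ell2_norm (\<lambda>i. x n i - y i) < e" by blast
      then have "limitin M.mtopology \<sigma> (y, undefined) sequentially"
        unfolding M.limit_metric_sequentially using \<sigma> by (auto simp: hdist_ell2_space x(2))
      then show "\<exists>l. limitin M.mtopology \<sigma> l sequentially" by blast
    qed
  qed
  ultimately show ?thesis by (rule hilbert_space.intro)
qed

section \<open>Affine actions that permute coordinates\<close>

lemma ell2_reindex:
  assumes "x \<in> ell2" "inj \<tau>"
  shows "(\<lambda>i. x (\<tau> i)) \<in> ell2" "ell2_norm (\<lambda>i. x (\<tau> i)) \<le> ell2_norm x"
proof -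
  have "(\<Sum>i<n. (x (\<tau> i))\<^sup>2) \<le> (ell2_norm x)\<^sup>2" for n
  proof -
    have "(\<Sum>i<n. (x (\<tau> i))\<^sup>2) = (\<Sum>k\<in>\<tau> ` {..<n}. (x k)\<^sup>2)"
      using assms(2) by (subst sum.reindex) (auto intro: inj_on_subset)
    also have "\<dots> \<le> (ell2_norm x)\<^sup>2" by (intro ell2_sum_le assms) simp
    finally show ?thesis .
  qed
  note bounded = ell2_bounded[OF this]
  show "(\<lambda>i. x (\<tau> i)) \<in> ell2" by (rule bounded(1))
  have "sqrt (\<Sum>i. (x (\<tau> i))\<^sup>2) \<le> sqrt ((ell2_norm x)\<^sup>2)" using bounded(2) by (rule real_sqrt_le_mono)
  then show "ell2_norm (\<lambda>i. x (\<tau> i)) \<le> ell2_norm x"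
    using ell2_norm_nonneg[OF assms(1)] by (simp add: ell2_norm_def)
qed

text \<open>
  The group acts on indices from the right by \<open>\<tau>\<close>, hence on sequences from the left. The sequence \<open>F\<close> is
  usually not square summable, only its displacements \<open>F \<circ> \<tau> \<gamma> - F\<close> are. Conjugating the linear action by
  the formal translation by \<open>F\<close> gives \<open>v \<mapsto> (v + F) \<circ> \<tau> \<gamma> - F\<close>: an action for formal reasons, and an
  affine isometry of the space because its linear part permutes coordinates. The orbit of \<open>0\<close> is the
  embedding.
\<close>
locale permutation_coboundary = marked_group +
  fixes \<tau> :: "'a \<Rightarrow> nat \<Rightarrow> nat" and F :: "nat \<Rightarrow> real"
  assumes \<tau>_one: "\<tau> \<one> i = i"
    and \<tau>_mult: "\<gamma> \<in> carrier G \<Longrightarrow> \<delta> \<in> carrier G \<Longrightarrow> \<tau> (\<gamma> \<otimes> \<delta>) i = \<tau> \<delta> (\<tau> \<gamma> i)"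
    and coboundary_ell2: "\<gamma> \<in> carrier G \<Longrightarrow> (\<lambda>i. F (\<tau> \<gamma> i) - F i) \<in> ell2"
begin

lemma \<tau>_inv: "\<gamma> \<in> carrier G \<Longrightarrow> \<tau> (inv \<gamma>) (\<tau> \<gamma> i) = i" "\<gamma> \<in> carrier G \<Longrightarrow> \<tau> \<gamma> (\<tau> (inv \<gamma>) i) = i"
  by (simp_all add: \<tau>_mult[symmetric] \<tau>_one)

lemma inj_\<tau>: "\<gamma> \<in> carrier G \<Longrightarrow> inj (\<tau> \<gamma>)"
  by (rule inj_on_inverseI[where g = "\<tau> (inv \<gamma>)"]) (simp add: \<tau>_inv)

lemma translate_ell2: "x \<in> ell2 \<Longrightarrow> \<gamma> \<in> carrier G \<Longrightarrow> (\<lambda>i. x (\<tau> \<gamma> i)) \<in> ell2"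
  by (rule ell2_reindex(1)[OF _ inj_\<tau>])

lemma translate_norm:
  assumes "x \<in> ell2" "\<gamma> \<in> carrier G"
  shows "ell2_norm (\<lambda>i. x (\<tau> \<gamma> i)) = ell2_norm x"
proof (rule antisym)
  show "ell2_norm (\<lambda>i. x (\<tau> \<gamma> i)) \<le> ell2_norm x"
    by (rule ell2_reindex(2)[OF assms(1) inj_\<tau>[OF assms(2)]])
  have "ell2_norm (\<lambda>i. x (\<tau> \<gamma> (\<tau> (inv \<gamma>) i))) \<le> ell2_norm (\<lambda>i. x (\<tau> \<gamma> i))"
    by (rule ell2_reindex(2)[OF translate_ell2[OF assms] inj_\<tau>[OF inv_closed[OF assms(2)]]])
  then show "ell2_norm x \<le> ell2_norm (\<lambda>i. x (\<tau> \<gamma> i))" using assms by (simp add: \<tau>_inv)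
qed

definition act :: "'a \<Rightarrow> (nat \<Rightarrow> real) \<times> 'u \<Rightarrow> (nat \<Rightarrow> real) \<times> 'u" where
  "act \<gamma> = (\<lambda>v\<in>carrier ell2_space. (\<lambda>i. fst v (\<tau> \<gamma> i) + (F (\<tau> \<gamma> i) - F i), undefined))"

definition orbit :: "'a \<Rightarrow> (nat \<Rightarrow> real) \<times> 'u" where
  "orbit x = (\<lambda>i. F (\<tau> x i) - F i, undefined)"

lemma act_apply: "v \<in> ell2 \<Longrightarrow> act \<gamma> (v, undefined) = (\<lambda>i. v (\<tau> \<gamma> i) + (F (\<tau> \<gamma> i) - F i), undefined)"
  by (simp add: act_def)

lemma act_closed: "\<gamma> \<in> carrier G \<Longrightarrow> v \<in> carrier ell2_space \<Longrightarrow> act \<gamma> v \<in> carrier ell2_space"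
  by (auto simp: act_apply translate_ell2 coboundary_ell2 ell2_triangle(1))

lemma act_mult:
  assumes "\<gamma> \<in> carrier G" "\<delta> \<in> carrier G" "v \<in> carrier ell2_space"
  shows "act (\<gamma> \<otimes> \<delta>) v = act \<gamma> (act \<delta> v)"
proof -
  obtain w where v: "v = (w, undefined)" "w \<in> ell2" using assms(3) by auto
  have "(\<lambda>i. w (\<tau> \<delta> i) + (F (\<tau> \<delta> i) - F i)) \<in> ell2"
    using act_closed[OF assms(2,3)] v by (simp add: act_apply)
  then show ?thesis using assms v by (simp add: act_apply \<tau>_mult)
qed

lemma act_one: "v \<in> carrier ell2_space \<Longrightarrow> act \<one> v = v"
  by (auto simp: act_apply \<tau>_one)

lemma act_affine_isometry:
  assumes \<gamma>: "\<gamma> \<in> carrier G"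
  shows "act \<gamma> \<in> affine_isometries ell2_space"
proof -
  have "bij_betw (act \<gamma>) (carrier ell2_space) (carrier ell2_space)"
  proof (rule bij_betw_byWitness[where f' = "act (inv \<gamma>)"])
    show "\<forall>v\<in>carrier ell2_space. act (inv \<gamma>) (act \<gamma> v) = v"
      "\<forall>v\<in>carrier ell2_space. act \<gamma> (act (inv \<gamma>) v) = v"
      using \<gamma> by (auto simp: act_mult[symmetric] act_one simp del: ell2_space_simps)
  qed (intro image_subsetI act_closed inv_closed \<gamma>, assumption)+
  moreover have "act \<gamma> \<in> extensional (carrier ell2_space)" by (simp add: act_def)
  moreover have "hdist ell2_space (act \<gamma> v) (act \<gamma> w) = hdist ell2_space v w"
    if "v \<in> carrier ell2_space" "w \<in> carrier ell2_space" for v w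
  proof -
    obtain x y where v: "v = (x, undefined)" "x \<in> ell2" and w: "w = (y, undefined)" "y \<in> ell2"
      using \<open>v \<in> carrier ell2_space\<close> \<open>w \<in> carrier ell2_space\<close> by auto
    have "ell2_part (act \<gamma> v) = (\<lambda>i. x (\<tau> \<gamma> i) + (F (\<tau> \<gamma> i) - F i))"
      "ell2_part (act \<gamma> w) = (\<lambda>i. y (\<tau> \<gamma> i) + (F (\<tau> \<gamma> i) - F i))"
      using act_closed[OF \<gamma> that(1)] act_closed[OF \<gamma> that(2)] v w by (auto simp: act_apply)
    then show ?thesis
      using translate_norm[of "\<lambda>i. x i - y i" \<gamma>] v w \<gamma> by (simp add: hdist_ell2_space ell2_diff)
  qed
  moreover have "act \<gamma> ((1 - t) \<odot>\<^bsub>ell2_space\<^esub> v \<oplus>\<^bsub>ell2_space\<^esub> t \<odot>\<^bsub>ell2_space\<^esub> w)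
      = (1 - t) \<odot>\<^bsub>ell2_space\<^esub> act \<gamma> v \<oplus>\<^bsub>ell2_space\<^esub> t \<odot>\<^bsub>ell2_space\<^esub> act \<gamma> w"
    if "v \<in> carrier ell2_space" "w \<in> carrier ell2_space" for v w t
  proof -
    obtain x y where v: "v = (x, undefined)" "x \<in> ell2" and w: "w = (y, undefined)" "y \<in> ell2"
      using \<open>v \<in> carrier ell2_space\<close> \<open>w \<in> carrier ell2_space\<close> by auto
    have "fst (act \<gamma> v) \<in> ell2" "fst (act \<gamma> w) \<in> ell2"
      using act_closed[OF \<gamma> that(1)] act_closed[OF \<gamma> that(2)] by auto
    moreover have "(\<lambda>i. (1 - t) * x i + t * y i) \<in> ell2"
      using v w by (intro ell2_triangle ell2_scale)
    ultimately show ?thesis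
      using v w by (simp add: ell2_scale act_apply) (simp add: algebra_simps)
  qed
  ultimately show ?thesis unfolding affine_isometries_def Bij_def by blast
qed

lemma act_hom: "(act :: 'a \<Rightarrow> (nat \<Rightarrow> real) \<times> 'u \<Rightarrow> (nat \<Rightarrow> real) \<times> 'u) \<in> hom G (isometry_group ell2_space)"
proof (rule homI)
  fix \<gamma> assume "\<gamma> \<in> carrier G"
  then show "(act \<gamma> :: (nat \<Rightarrow> real) \<times> 'u \<Rightarrow> _) \<in> carrier (isometry_group ell2_space)"
    by (simp add: isometry_group_def act_affine_isometry)
next
  fix \<gamma> \<delta> assume *: "\<gamma> \<in> carrier G" "\<delta> \<in> carrier G"
  have Bij: "(act \<gamma> :: (nat \<Rightarrow> real) \<times> 'u \<Rightarrow> _) \<in> Bij (carrier ell2_space)" if "\<gamma> \<in> carrier G" for \<gamma>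
    using act_affine_isometry[OF that] unfolding affine_isometries_def by blast
  have "(act (\<gamma> \<otimes> \<delta>) :: (nat \<Rightarrow> real) \<times> 'u \<Rightarrow> _) = compose (carrier ell2_space) (act \<gamma>) (act \<delta>)"
  proof (rule extensionalityI[of _ "carrier ell2_space"])
    show "act (\<gamma> \<otimes> \<delta>) v = compose (carrier ell2_space) (act \<gamma>) (act \<delta>) v"
      if "v \<in> carrier ell2_space" for v :: "(nat \<Rightarrow> real) \<times> 'u"
      using * that by (simp add: compose_def act_mult del: ell2_space_simps)
  qed (simp_all add: act_def)
  then show "(act (\<gamma> \<otimes> \<delta>) :: (nat \<Rightarrow> real) \<times> 'u \<Rightarrow> _) = act \<gamma> \<otimes>\<^bsub>isometry_group ell2_space\<^esub> act \<delta>"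
    using * Bij by (simp add: isometry_group_def BijGroup_def del: ell2_space_simps)
qed

lemma orbit_closed: "x \<in> carrier G \<Longrightarrow> orbit x \<in> carrier ell2_space"
  by (simp add: orbit_def coboundary_ell2)

lemma orbit_equivariant:
  "\<gamma> \<in> carrier G \<Longrightarrow> x \<in> carrier G \<Longrightarrow> orbit (\<gamma> \<otimes> x) = act \<gamma> (orbit x)"
  by (simp add: orbit_def act_apply coboundary_ell2 \<tau>_mult)

lemma hdist_orbit:
  assumes "x \<in> carrier G" "y \<in> carrier G"
  shows "hdist ell2_space (orbit x) (orbit y) = ell2_norm (\<lambda>i. F (\<tau> (inv y \<otimes> x) i) - F i)"
proof -
  have "x = y \<otimes> (inv y \<otimes> x)" using assms by (simp add: m_assoc[symmetric])
  then have *: "\<tau> x i = \<tau> (inv y \<otimes> x) (\<tau> y i)" for i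
    using \<tau>_mult[of y "inv y \<otimes> x" i] assms by simp
  have "hdist ell2_space (orbit x) (orbit y) = ell2_norm (\<lambda>i. F (\<tau> x i) - F (\<tau> y i))"
    using assms by (simp add: hdist_ell2_space orbit_def coboundary_ell2)
  also have "\<dots> = ell2_norm (\<lambda>i. (\<lambda>k. F (\<tau> (inv y \<otimes> x) k) - F k) (\<tau> y i))"
    unfolding * ..
  also have "\<dots> = ell2_norm (\<lambda>i. F (\<tau> (inv y \<otimes> x) i) - F i)"
    using assms by (intro translate_norm coboundary_ell2) auto
  finally show ?thesis .
qed

text \<open>
  Equivariance reduces all distances to displacements from the base point, so two-sided bounds on the
  displacements are enough.
\<close>
lemma compression_exponent_orbit_ge:
  assumes "\<kappa> > 0" "0 < c" "c \<le> 1"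
    and lower: "\<And>\<gamma>. \<gamma> \<in> carrier G \<Longrightarrow> \<kappa> * real (len \<gamma>) powr c \<le> ell2_norm (\<lambda>i. F (\<tau> \<gamma> i) - F i)"
    and upper: "\<And>\<gamma>. \<gamma> \<in> carrier G \<Longrightarrow> ell2_norm (\<lambda>i. F (\<tau> \<gamma> i) - F i) \<le> C * real (len \<gamma>)"
  shows "c \<le> equivariant_compression_exponent TYPE('u) G S"
proof -
  let ?B = "ell2_space :: ((nat \<Rightarrow> real) \<times> 'u) inner_space"
  define \<rho> where "\<rho> = (\<lambda>t::real. \<kappa> * t powr c)"
  have comp: "compression_function G S ?B orbit \<rho>"
    unfolding compression_function_def
  proof (intro conjI ballI allI impI)
    show "mono_on {0..} \<rho>"
      using assms by (auto simp: \<rho>_def intro!: mono_onI mult_left_mono powr_mono2)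
    show "\<not> bdd_above (\<rho> ` {0..})"
    proof
      assume "bdd_above (\<rho> ` {0..})"
      then obtain M where M: "\<And>t. t \<ge> 0 \<Longrightarrow> \<rho> t \<le> M" by (auto simp: bdd_above_def)
      have "filterlim \<rho> at_top at_top" unfolding \<rho>_def using assms by real_asymp
      then have "eventually (\<lambda>t. M < \<rho> t \<and> t \<ge> 0) at_top"
        by (intro eventually_conj eventually_ge_at_top) (auto simp: filterlim_at_top_dense)
      then obtain t where "M < \<rho> t" "t \<ge> 0" by (auto simp: eventually_at_top_linorder)
      then show False using M by fastforce
    qed
    show "\<rho> (real (len (inv y \<otimes> x))) \<le> hdist ?B (orbit x) (orbit y)"
      if "x \<in> carrier G" "y \<in> carrier G" for x y
      unfolding hdist_orbit[OF that] \<rho>_def using that by (intro lower) auto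
  qed (use assms in \<open>auto simp: \<rho>_def\<close>)
  have "equivariant_uniform_embedding G S ?B act orbit"
    unfolding equivariant_uniform_embedding_def
  proof (intro conjI ballI exI)
    show "compression_function G S ?B orbit \<rho>" by (rule comp)
    show "orbit \<in> carrier G \<rightarrow> carrier ?B" using orbit_closed by (auto simp del: ell2_space_simps)
    show "0 < \<bar>C\<bar> + 1" by simp
    show "hdist ?B (orbit x) (orbit y) \<le> (\<bar>C\<bar> + 1) * real (len (inv y \<otimes> x)) + (\<bar>C\<bar> + 1)"
      if "x \<in> carrier G" "y \<in> carrier G" for x y
    proof -
      have "hdist ?B (orbit x) (orbit y) \<le> C * real (len (inv y \<otimes> x))"
        unfolding hdist_orbit[OF that] using that by (intro upper) auto
      also have "\<dots> \<le> (\<bar>C\<bar> + 1) * real (len (inv y \<otimes> x))" by (intro mult_right_mono) auto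
      finally show ?thesis by simp
    qed
  qed (simp add: orbit_equivariant)
  moreover have "c \<le> compression_exponent G S ?B orbit"
    unfolding compression_exponent_def
    using assms comp by (intro sup_unit_ge) (auto simp: \<rho>_def intro!: exI[of _ \<kappa>] exI[of _ \<rho>])
  moreover have "compression_exponent G S ?B orbit \<le> equivariant_compression_exponent TYPE('u) G S"
    unfolding equivariant_compression_exponent_def
  proof (rule sup_unit_ge)
    show "{compression_exponent G S B f | (B :: ((nat \<Rightarrow> real) \<times> 'u) inner_space) \<pi> f.
        hilbert_space B \<and> \<pi> \<in> hom G (isometry_group B) \<and> equivariant_uniform_embedding G S B \<pi> f} \<subseteq> {0..1}"
      using compression_exponent_in_unit by blast
  qed (use calculation hilbert_space_ell2_space act_hom in blast)
  ultimately show ?thesis by linarith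
qed

end

section \<open>An embedding built from exponential weights\<close>

context marked_group
begin

lemma len_diff_le:
  assumes "\<gamma> \<in> carrier G" "x \<in> carrier G"
  shows "\<bar>real (len (inv \<gamma> \<otimes> x)) - real (len x)\<bar> \<le> real (len \<gamma>)"
proof -
  have "len (inv \<gamma> \<otimes> x) \<le> len \<gamma> + len x" using len_mult[of "inv \<gamma>" x] assms by simp
  moreover have "len x \<le> len \<gamma> + len (inv \<gamma> \<otimes> x)" using len_le_mult_inv assms by simp
  ultimately show ?thesis by linarith
qed

lemma inj_left_translate: "\<gamma> \<in> carrier G \<Longrightarrow> X \<subseteq> carrier G \<Longrightarrow> inj_on (\<lambda>x. inv \<gamma> \<otimes> x) X"
  by (auto simp: inj_on_def subset_iff)

definition weight :: "real \<Rightarrow> 'a \<Rightarrow> real" where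
  "weight \<eta> x = exp (- (\<eta> * real (len x)))"

definition mass :: "real \<Rightarrow> real" where
  "mass \<eta> = (\<Sum>\<^sub>\<infinity>x\<in>carrier G. (weight \<eta> x)\<^sup>2)"

text \<open>
  At scale \<open>m\<close> the weight is concentrated within radius \<open>m / 2\<close>. The bound \<open>1 / 4\<close> is a fixed proportion
  of the mass, because the identity alone contributes \<open>1\<close> to the mass. Quantifying over finite sets
  yields summability as a consequence.
\<close>
definition thin_tail :: "real \<Rightarrow> nat \<Rightarrow> bool" where
  "thin_tail \<eta> m \<longleftrightarrow> (\<forall>X. finite X \<longrightarrow> X \<subseteq> {x \<in> carrier G. m \<le> 2 * len x} \<longrightarrow> (\<Sum>x\<in>X. (weight \<eta> x)\<^sup>2) \<le> 1 / 4)"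

lemma sum_le_core:
  assumes tail: "thin_tail \<eta> m" and X: "finite X" "X \<subseteq> carrier G"
  shows "(\<Sum>x\<in>X. (weight \<eta> x)\<^sup>2) \<le> (\<Sum>x | x \<in> carrier G \<and> 2 * len x < m. (weight \<eta> x)\<^sup>2) + 1 / 4"
proof -
  let ?A = "{x \<in> carrier G. 2 * len x < m}"
  have fin: "finite ?A" by (rule finite_subset[OF _ finite_ball[of m]]) (auto simp: mem_ball)
  have "(\<Sum>x\<in>X. (weight \<eta> x)\<^sup>2) = (\<Sum>x\<in>X \<inter> ?A. (weight \<eta> x)\<^sup>2) + (\<Sum>x\<in>X - ?A. (weight \<eta> x)\<^sup>2)"
    using X by (subst sum.union_disjoint[symmetric]) (auto intro!: sum.cong)
  also have "(\<Sum>x\<in>X \<inter> ?A. (weight \<eta> x)\<^sup>2) \<le> (\<Sum>x\<in>?A. (weight \<eta> x)\<^sup>2)"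
    using fin by (intro sum_mono2) auto
  also have "(\<Sum>x\<in>X - ?A. (weight \<eta> x)\<^sup>2) \<le> 1 / 4"
    by (rule tail[unfolded thin_tail_def, rule_format]) (use X in auto)
  finally show ?thesis by simp
qed

lemma weight_summable:
  assumes "thin_tail \<eta> m"
  shows "(\<lambda>x. (weight \<eta> x)\<^sup>2) summable_on carrier G"
proof (rule nonneg_bdd_above_summable_on)
  show "bdd_above (sum (\<lambda>x. (weight \<eta> x)\<^sup>2) ` {X. X \<subseteq> carrier G \<and> finite X})"
    by (rule bdd_aboveI2[OF sum_le_core[OF assms]]) auto
qed simp

lemma sum_le_mass: "thin_tail \<eta> m \<Longrightarrow> finite X \<Longrightarrow> X \<subseteq> carrier G \<Longrightarrow> (\<Sum>x\<in>X. (weight \<eta> x)\<^sup>2) \<le> mass \<eta>"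
  unfolding mass_def by (intro finite_sum_le_infsum weight_summable) auto

lemma mass_le_core:
  assumes "thin_tail \<eta> m"
  shows "mass \<eta> \<le> (\<Sum>x | x \<in> carrier G \<and> 2 * len x < m. (weight \<eta> x)\<^sup>2) + 1 / 4"
  unfolding mass_def
  by (intro infsum_le_finite_sums weight_summable[OF assms] sum_le_core[OF assms])

lemma mass_ge_1: "thin_tail \<eta> m \<Longrightarrow> 1 \<le> mass \<eta>"
  using sum_le_mass[of \<eta> m "{\<one>}"] by (simp add: weight_def)

text \<open>
  Translation by \<open>\<gamma>\<close> changes lengths by at most \<open>\<bar>\<gamma>\<bar>\<close>, so the difference at \<open>x\<close> is at most \<open>\<eta> \<bar>\<gamma>\<bar>\<close> times the
  sum of the two values, and each value contributes at most the mass.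
\<close>
lemma weight_gradient_le:
  assumes tail: "thin_tail \<eta> m" and "\<eta> \<ge> 0" and X: "finite X" "X \<subseteq> carrier G" and \<gamma>: "\<gamma> \<in> carrier G"
  shows "(\<Sum>x\<in>X. (weight \<eta> (inv \<gamma> \<otimes> x) - weight \<eta> x)\<^sup>2) \<le> 4 * \<eta>\<^sup>2 * (real (len \<gamma>))\<^sup>2 * mass \<eta>"
proof -
  have "(\<Sum>x\<in>X. (weight \<eta> (inv \<gamma> \<otimes> x) - weight \<eta> x)\<^sup>2)
      \<le> (\<Sum>x\<in>X. (\<eta> * real (len \<gamma>))\<^sup>2 * (2 * ((weight \<eta> (inv \<gamma> \<otimes> x))\<^sup>2 + (weight \<eta> x)\<^sup>2)))"
  proof (rule sum_mono)
    fix x assume "x \<in> X"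
    then have x: "x \<in> carrier G" using X by auto
    have "\<bar>weight \<eta> (inv \<gamma> \<otimes> x) - weight \<eta> x\<bar>
        \<le> \<bar>\<eta> * real (len (inv \<gamma> \<otimes> x)) - \<eta> * real (len x)\<bar> * (weight \<eta> (inv \<gamma> \<otimes> x) + weight \<eta> x)"
      unfolding weight_def by (rule exp_minus_diff_le)
    also have "\<bar>\<eta> * real (len (inv \<gamma> \<otimes> x)) - \<eta> * real (len x)\<bar>
        = \<eta> * \<bar>real (len (inv \<gamma> \<otimes> x)) - real (len x)\<bar>"
      using \<open>\<eta> \<ge> 0\<close> by (simp add: right_diff_distrib[symmetric] abs_mult)
    also have "\<dots> * (weight \<eta> (inv \<gamma> \<otimes> x) + weight \<eta> x)
        \<le> (\<eta> * real (len \<gamma>)) * (weight \<eta> (inv \<gamma> \<otimes> x) + weight \<eta> x)"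
      using len_diff_le[OF \<gamma> x] \<open>\<eta> \<ge> 0\<close> by (intro mult_right_mono mult_left_mono) (auto simp: weight_def)
    finally have "\<bar>weight \<eta> (inv \<gamma> \<otimes> x) - weight \<eta> x\<bar>\<^sup>2
        \<le> ((\<eta> * real (len \<gamma>)) * (weight \<eta> (inv \<gamma> \<otimes> x) + weight \<eta> x))\<^sup>2"
      by (intro power_mono) auto
    also have "\<dots> = (\<eta> * real (len \<gamma>))\<^sup>2 * (weight \<eta> (inv \<gamma> \<otimes> x) + weight \<eta> x)\<^sup>2"
      by (rule power_mult_distrib)
    also have "\<dots> \<le> (\<eta> * real (len \<gamma>))\<^sup>2 * (2 * ((weight \<eta> (inv \<gamma> \<otimes> x))\<^sup>2 + (weight \<eta> x)\<^sup>2))"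
      by (intro mult_left_mono sq_sum_le) simp
    finally show "(weight \<eta> (inv \<gamma> \<otimes> x) - weight \<eta> x)\<^sup>2
        \<le> (\<eta> * real (len \<gamma>))\<^sup>2 * (2 * ((weight \<eta> (inv \<gamma> \<otimes> x))\<^sup>2 + (weight \<eta> x)\<^sup>2))" by simp
  qed
  also have "\<dots> = (\<eta> * real (len \<gamma>))\<^sup>2 * (2 * ((\<Sum>x\<in>X. (weight \<eta> (inv \<gamma> \<otimes> x))\<^sup>2) + (\<Sum>x\<in>X. (weight \<eta> x)\<^sup>2)))"
    by (simp add: sum_distrib_left sum.distrib[symmetric])
  also have "\<dots> \<le> (\<eta> * real (len \<gamma>))\<^sup>2 * (2 * (mass \<eta> + mass \<eta>))"
  proof (intro mult_left_mono add_mono)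
    have "(\<Sum>x\<in>X. (weight \<eta> (inv \<gamma> \<otimes> x))\<^sup>2) = (\<Sum>y\<in>(\<lambda>x. inv \<gamma> \<otimes> x) ` X. (weight \<eta> y)\<^sup>2)"
      by (simp add: sum.reindex inj_left_translate X \<gamma>)
    also have "\<dots> \<le> mass \<eta>" using X \<gamma> by (intro sum_le_mass[OF tail]) auto
    finally show "(\<Sum>x\<in>X. (weight \<eta> (inv \<gamma> \<otimes> x))\<^sup>2) \<le> mass \<eta>" .
  qed (use sum_le_mass[OF tail X] in auto)
  finally show ?thesis by (simp add: power_mult_distrib)
qed

text \<open>
  On the ball of radius \<open>\<bar>\<gamma>\<bar> / 2\<close> the function keeps all but \<open>1 / 4\<close> of its mass, whereas its translate lives
  in the tail there, since \<open>\<bar>\<gamma>\<^sup>-\<^sup>1 x\<bar> \<ge> \<bar>\<gamma>\<bar> / 2\<close>. The two are therefore far apart.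
\<close>
lemma weight_displacement_ge:
  assumes tail: "thin_tail \<eta> m" and \<gamma>: "\<gamma> \<in> carrier G" and "m \<le> len \<gamma>"
  shows "mass \<eta> / 8 \<le> (\<Sum>x | x \<in> carrier G \<and> 2 * len x < len \<gamma>. (weight \<eta> (inv \<gamma> \<otimes> x) - weight \<eta> x)\<^sup>2)"
proof -
  let ?A = "{x \<in> carrier G. 2 * len x < len \<gamma>}"
  have fin: "finite ?A" by (rule finite_subset[OF _ finite_ball[of "len \<gamma>"]]) (auto simp: mem_ball)
  have tail': "thin_tail \<eta> (len \<gamma>)"
    unfolding thin_tail_def
  proof (intro allI impI)
    fix X assume "finite X" "X \<subseteq> {x \<in> carrier G. len \<gamma> \<le> 2 * len x}"
    moreover from this have "X \<subseteq> {x \<in> carrier G. m \<le> 2 * len x}" using \<open>m \<le> len \<gamma>\<close> by auto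
    ultimately show "(\<Sum>x\<in>X. (weight \<eta> x)\<^sup>2) \<le> 1 / 4"
      using tail by (simp add: thin_tail_def)
  qed
  have "(\<Sum>x\<in>?A. (weight \<eta> (inv \<gamma> \<otimes> x))\<^sup>2) = (\<Sum>y\<in>(\<lambda>x. inv \<gamma> \<otimes> x) ` ?A. (weight \<eta> y)\<^sup>2)"
    by (subst sum.reindex) (auto intro: inj_left_translate \<gamma>)
  also have "\<dots> \<le> 1 / 4"
  proof (rule tail'[unfolded thin_tail_def, rule_format])
    show "(\<lambda>x. inv \<gamma> \<otimes> x) ` ?A \<subseteq> {x \<in> carrier G. len \<gamma> \<le> 2 * len x}"
    proof safe
      fix x assume x: "x \<in> carrier G" "2 * len x < len \<gamma>"
      have "len (inv \<gamma> \<otimes> x) = len (inv (inv \<gamma> \<otimes> x))" using x \<gamma> by simp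
      also have "inv (inv \<gamma> \<otimes> x) = inv x \<otimes> \<gamma>" using x \<gamma> by (simp add: inv_mult_group)
      finally show "len \<gamma> \<le> 2 * len (inv \<gamma> \<otimes> x)" using len_le_mult_inv[OF \<gamma> x(1)] x(2) by simp
    qed (use \<gamma> in auto)
  qed (use fin in simp)
  finally have moved: "(\<Sum>x\<in>?A. (weight \<eta> (inv \<gamma> \<otimes> x))\<^sup>2) \<le> 1 / 4" .
  have "mass \<eta> - 1 / 4 \<le> (\<Sum>x\<in>?A. (weight \<eta> x)\<^sup>2)" using mass_le_core[OF tail'] by simp
  then have "mass \<eta> / 8 \<le> (\<Sum>x\<in>?A. (weight \<eta> x)\<^sup>2) / 2 - (\<Sum>x\<in>?A. (weight \<eta> (inv \<gamma> \<otimes> x))\<^sup>2)"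
    using moved mass_ge_1[OF tail] by simp
  also have "\<dots> = (\<Sum>x\<in>?A. (weight \<eta> x)\<^sup>2 / 2 - (weight \<eta> (inv \<gamma> \<otimes> x))\<^sup>2)"
    by (simp add: sum_subtractf sum_divide_distrib)
  also have "\<dots> \<le> (\<Sum>x\<in>?A. (weight \<eta> x - weight \<eta> (inv \<gamma> \<otimes> x))\<^sup>2)"
    by (intro sum_mono sq_diff_ge)
  also have "\<dots> = (\<Sum>x\<in>?A. (weight \<eta> (inv \<gamma> \<otimes> x) - weight \<eta> x)\<^sup>2)"
    by (simp add: power2_commute)
  finally show ?thesis .
qed

end

context stretched_growth
begin

text \<open>
  If \<open>2 \<bar>x\<bar> \<ge> 2\<^sup>j\<close>, then \<open>2 \<eta> \<bar>x\<bar> \<ge> C (2 \<bar>x\<bar>)\<^sup>\<nu> \<ge> C \<bar>x\<bar>\<^sup>\<nu>\<close>, because \<open>\<nu> - 1 \<le> 0\<close>. The tail is thus at most a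
  multiple of \<open>\<Sum>r. exp (- (C - K) r\<^sup>\<nu>)\<close> over \<open>r \<ge> 1\<close>, which is small for large \<open>C\<close>, uniformly in the scale.
\<close>
lemma ex_thin_tail:
  "\<exists>C>0. \<forall>j. thin_tail (C * (2 ^ j) powr (\<nu> - 1)) (2 ^ j)"
proof -
  define T where "T = (\<Sum>r. exp (- (real (Suc r) powr \<nu>)))"
  have summable: "summable (\<lambda>r. exp (- (real (Suc r) powr \<nu>)))"
    using summable_stretched_exp[of 1 \<nu>] \<nu>_pos by (subst summable_Suc_iff) simp
  have "T \<ge> 0" unfolding T_def by (intro suminf_nonneg summable) simp
  \<comment> \<open>chosen such that 4 L T exp (- D) = D exp (- D) is at most 1\<close>
  define D where "D = 4 * L * T"
  have "D \<ge> 0" using \<open>T \<ge> 0\<close> L_pos by (simp add: D_def)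
  define C where "C = K + 1 + D"
  have "C > K" "C > 0" using \<open>D \<ge> 0\<close> K_pos by (auto simp: C_def)
  have small: "L * (\<Sum>r. exp (- (C - K) * real (Suc r) powr \<nu>)) \<le> 1 / 4"
  proof -
    have "(\<Sum>r. exp (- (C - K) * real (Suc r) powr \<nu>)) \<le> (\<Sum>r. exp (- D) * exp (- (real (Suc r) powr \<nu>)))"
    proof (rule suminf_le)
      show "summable (\<lambda>r. exp (- (C - K) * real (Suc r) powr \<nu>))"
        using summable_stretched_exp[of "C - K" \<nu>] \<nu>_pos \<open>C > K\<close> by (subst summable_Suc_iff) simp
      show "summable (\<lambda>r. exp (- D) * exp (- (real (Suc r) powr \<nu>)))"
        by (rule summable_mult[OF summable])
      fix r
      have "1 \<le> real (Suc r) powr \<nu>" using \<nu>_pos by (intro ge_one_powr_ge_zero) auto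
      then have "D * 1 \<le> D * real (Suc r) powr \<nu>" using \<open>D \<ge> 0\<close> by (intro mult_left_mono) auto
      then have "- (C - K) * real (Suc r) powr \<nu> \<le> - D - real (Suc r) powr \<nu>"
        by (simp add: C_def algebra_simps)
      then show "exp (- (C - K) * real (Suc r) powr \<nu>) \<le> exp (- D) * exp (- (real (Suc r) powr \<nu>))"
        by (simp add: exp_add[symmetric])
    qed
    also have "\<dots> = exp (- D) * T" unfolding T_def by (rule suminf_mult[OF summable])
    finally have "4 * (L * (\<Sum>r. exp (- (C - K) * real (Suc r) powr \<nu>))) \<le> 4 * (L * (exp (- D) * T))"
      using L_pos by (intro mult_left_mono) auto
    also have "\<dots> = D * exp (- D)" by (simp add: D_def)
    also have "\<dots> \<le> exp D * exp (- D)"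
    proof (rule mult_right_mono)
      show "D \<le> exp D" using exp_ge_add_one_self[of D] by linarith
    qed simp
    also have "\<dots> = 1" by (simp add: exp_minus)
    finally show ?thesis by simp
  qed
  have "thin_tail (C * (2 ^ j) powr (\<nu> - 1)) (2 ^ j)" for j
    unfolding thin_tail_def
  proof (intro allI impI)
    fix X assume fin: "finite X" and X: "X \<subseteq> {x \<in> carrier G. 2 ^ j \<le> 2 * len x}"
    define \<eta> where "\<eta> = C * (2 ^ j) powr (\<nu> - 1)"
    have "(\<Sum>x\<in>X. (weight \<eta> x)\<^sup>2) \<le> (\<Sum>x\<in>X. exp (- C * real (len x) powr \<nu>))"
    proof (rule sum_mono)
      fix x assume "x \<in> X"
      then have x: "2 ^ j \<le> 2 * len x" using X by auto
      then have x': "(2::real) ^ j \<le> 2 * real (len x)"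
      proof -
        have "real (2 ^ j) \<le> real (2 * len x)" using x by (simp only: of_nat_le_iff)
        then show ?thesis by simp
      qed
      have pos: "real (len x) > 0" using x by (cases "len x") auto
      have "C * real (len x) powr \<nu> \<le> C * (2 * real (len x)) powr \<nu>"
        using \<nu>_pos \<open>C > 0\<close> by (intro mult_left_mono powr_mono2) auto
      also have "(2 * real (len x)) powr \<nu> = (2 * real (len x)) powr (1 + (\<nu> - 1))" by simp
      also have "\<dots> = (2 * real (len x)) powr 1 * (2 * real (len x)) powr (\<nu> - 1)" by (rule powr_add)
      also have "(2 * real (len x)) powr 1 = 2 * real (len x)" using pos by simp
      also have "C * (2 * real (len x) * (2 * real (len x)) powr (\<nu> - 1))
          \<le> C * (2 * real (len x) * (2 ^ j) powr (\<nu> - 1))"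
        using x' \<nu>_le_1 \<open>C > 0\<close> by (intro mult_left_mono powr_mono2') auto
      also have "\<dots> = 2 * (\<eta> * real (len x))" by (simp add: \<eta>_def)
      finally have "exp (- (2 * (\<eta> * real (len x)))) \<le> exp (- C * real (len x) powr \<nu>)" by simp
      then show "(weight \<eta> x)\<^sup>2 \<le> exp (- C * real (len x) powr \<nu>)"
        by (simp add: weight_def power2_eq_square exp_add[symmetric])
    qed
    also have "\<dots> \<le> L * (\<Sum>r. exp (- (C - K) * real (Suc r) powr \<nu>))"
      using fin X \<open>C > K\<close> by (intro sum_stretched_exp_le) (auto simp: not_le)
    also have "\<dots> \<le> 1 / 4" by (rule small)
    finally show "(\<Sum>x\<in>X. (weight (C * (2 ^ j) powr (\<nu> - 1)) x)\<^sup>2) \<le> 1 / 4" by (simp add: \<eta>_def)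
  qed
  then show ?thesis using \<open>C > 0\<close> by blast
qed

text \<open>
  The scales are combined as the coordinates \<open>\<Phi> j\<close>, enumerated by \<open>J\<close>. The square of the displacement at
  scale \<open>j\<close> is at most \<open>4 C\<^sup>2 q\<^sup>j \<bar>\<gamma>\<bar>\<^sup>2\<close> with \<open>q = 2\<^bsup>2 (c + \<nu> - 1)\<^esup> < 1\<close>, which gives the Lipschitz bound. For
  the lower bound only the scale with \<open>2\<^sup>j \<le> \<bar>\<gamma>\<bar> < 2\<^bsup>j + 1\<^esup>\<close> is used.
\<close>
lemma equivariant_compression_exponent_ge_of_less:
  assumes "0 < c" "c < 1 - \<nu>"
  shows "c \<le> equivariant_compression_exponent TYPE('u) G S"
proof -
  obtain C where "C > 0" and tail: "\<And>j. thin_tail (C * (2 ^ j) powr (\<nu> - 1)) (2 ^ j)"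
    using ex_thin_tail by blast
  define \<eta> :: "nat \<Rightarrow> real" where "\<eta> = (\<lambda>j. C * (2 ^ j) powr (\<nu> - 1))"
  define \<Phi> where "\<Phi> = (\<lambda>j x. (2 ^ j) powr c * weight (\<eta> j) x / sqrt (mass (\<eta> j)))"
  have \<eta>_nonneg: "\<eta> j \<ge> 0" for j using \<open>C > 0\<close> by (simp add: \<eta>_def)
  have tail: "thin_tail (\<eta> j) (2 ^ j)" for j using tail by (simp add: \<eta>_def)
  have mass: "mass (\<eta> j) > 0" for j using mass_ge_1[OF tail[of j]] by simp
  define q where "q = (2::real) powr (2 * (c + \<nu> - 1))"
  have "0 \<le> q" by (simp add: q_def)
  have "q < 1" unfolding q_def by (rule powr_less_one) (use assms in auto)
  have two_powr: "((2::real) ^ j) powr a = 2 powr (real j * a)" for j a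
  proof -
    have "(2::real) ^ j = 2 powr real j" by (rule powr_realpow[symmetric]) simp
    then show ?thesis by (simp only: powr_powr)
  qed
  have pow: "((2 ^ j) powr c)\<^sup>2 * (\<eta> j)\<^sup>2 = C\<^sup>2 * q ^ j" for j
  proof -
    have "((2 ^ j) powr c)\<^sup>2 * (\<eta> j)\<^sup>2 = C\<^sup>2 * ((2 ^ j) powr c * (2 ^ j) powr (\<nu> - 1))\<^sup>2"
      by (simp add: \<eta>_def power_mult_distrib)
    also have "((2::real) ^ j) powr c * (2 ^ j) powr (\<nu> - 1) = 2 powr (real j * (c + \<nu> - 1))"
      unfolding two_powr powr_add[symmetric] by (rule arg_cong[where f = "(powr) 2"]) (simp add: algebra_simps)
    also have "(2 powr (real j * (c + \<nu> - 1)))\<^sup>2 = q ^ j"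
    proof -
      have "q ^ j = q powr real j" by (rule powr_realpow[symmetric]) (simp add: q_def)
      also have "\<dots> = 2 powr (real j * (c + \<nu> - 1) + real j * (c + \<nu> - 1))"
        unfolding q_def powr_powr by (rule arg_cong[where f = "(powr) 2"]) (simp add: algebra_simps)
      also have "\<dots> = (2 powr (real j * (c + \<nu> - 1)))\<^sup>2" by (simp only: powr_add power2_eq_square)
      finally show ?thesis by (rule sym)
    qed
    finally show ?thesis .
  qed
  have difference_sq: "(\<Phi> j (inv \<gamma> \<otimes> x) - \<Phi> j x)\<^sup>2
      = ((2 ^ j) powr c)\<^sup>2 / mass (\<eta> j) * (weight (\<eta> j) (inv \<gamma> \<otimes> x) - weight (\<eta> j) x)\<^sup>2" for j \<gamma> x
  proof -
    have "\<Phi> j (inv \<gamma> \<otimes> x) - \<Phi> j x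
        = (2 ^ j) powr c / sqrt (mass (\<eta> j)) * (weight (\<eta> j) (inv \<gamma> \<otimes> x) - weight (\<eta> j) x)"
      by (simp add: \<Phi>_def algebra_simps diff_divide_distrib)
    then show ?thesis
      using mass[of j] by (simp add: power_mult_distrib power_divide)
  qed

  define A :: "(nat \<times> 'a) set" where "A = UNIV \<times> carrier G"
  define J where "J = from_nat_into A"
  define ix where "ix = to_nat_on A"
  have "countable A" using countable_carrier by (simp add: A_def)
  moreover have "infinite A" using one_closed by (auto simp: A_def finite_cartesian_product_iff)
  ultimately have J: "bij_betw J UNIV A" and J_ix: "\<And>p. p \<in> A \<Longrightarrow> J (ix p) = p" and ix_J: "\<And>i. ix (J i) = i"
    unfolding J_def ix_def by (auto intro: bij_betw_from_nat_into to_nat_on_from_nat_into_infinite)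
  have J_A: "J i \<in> A" for i using J by (auto simp: bij_betw_def)
  then have J_G: "snd (J i) \<in> carrier G" for i by (auto simp: A_def mem_Times_iff)
  define \<tau> where "\<tau> = (\<lambda>\<gamma> i. ix (fst (J i), inv \<gamma> \<otimes> snd (J i)))"
  define F where "F = (\<lambda>i. \<Phi> (fst (J i)) (snd (J i)))"
  have J_\<tau>: "J (\<tau> \<gamma> i) = (fst (J i), inv \<gamma> \<otimes> snd (J i))" if "\<gamma> \<in> carrier G" for \<gamma> i
    unfolding \<tau>_def using that J_G by (intro J_ix) (simp add: A_def)
  have difference: "F (\<tau> \<gamma> i) - F i = \<Phi> (fst (J i)) (inv \<gamma> \<otimes> snd (J i)) - \<Phi> (fst (J i)) (snd (J i))"
    if "\<gamma> \<in> carrier G" for \<gamma> i using J_\<tau>[OF that] by (simp add: F_def)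

  define M where "M = 4 * C\<^sup>2 * (1 / (1 - q))"
  have "M \<ge> 0" using \<open>q < 1\<close> by (simp add: M_def)
  have bounded: "(\<Sum>i<n. (F (\<tau> \<gamma> i) - F i)\<^sup>2) \<le> M * (real (len \<gamma>))\<^sup>2" if \<gamma>: "\<gamma> \<in> carrier G" for \<gamma> n
  proof -
    define X where "X = (\<lambda>i. snd (J i)) ` {..<n}"
    obtain k where k: "(\<lambda>i. fst (J i)) ` {..<n} \<subseteq> {..<k}"
      using finite_nat_set_iff_bounded[of "(\<lambda>i. fst (J i)) ` {..<n}"] by auto
    have X: "finite X" "X \<subseteq> carrier G" using J_G by (auto simp: X_def)
    have "(\<Sum>i<n. (F (\<tau> \<gamma> i) - F i)\<^sup>2)
        = (\<Sum>(j, x)\<in>J ` {..<n}. (\<Phi> j (inv \<gamma> \<otimes> x) - \<Phi> j x)\<^sup>2)"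
      using J by (subst sum.reindex)
        (auto simp: bij_betw_def difference[OF \<gamma>] case_prod_unfold intro: inj_on_subset)
    also have "\<dots> \<le> (\<Sum>(j, x)\<in>{..<k} \<times> X. (\<Phi> j (inv \<gamma> \<otimes> x) - \<Phi> j x)\<^sup>2)"
    proof (rule sum_mono2)
      show "J ` {..<n} \<subseteq> {..<k} \<times> X"
        using k by (auto simp: X_def image_subset_iff mem_Times_iff)
    qed (use X in auto)
    also have "\<dots> = (\<Sum>j<k. ((2 ^ j) powr c)\<^sup>2 / mass (\<eta> j) *
        (\<Sum>x\<in>X. (weight (\<eta> j) (inv \<gamma> \<otimes> x) - weight (\<eta> j) x)\<^sup>2))"
      by (simp add: sum.cartesian_product[symmetric] difference_sq sum_distrib_left)
    also have "\<dots> \<le> (\<Sum>j<k. ((2 ^ j) powr c)\<^sup>2 / mass (\<eta> j) *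
        (4 * (\<eta> j)\<^sup>2 * (real (len \<gamma>))\<^sup>2 * mass (\<eta> j)))"
      using mass by (intro sum_mono mult_left_mono weight_gradient_le[OF tail \<eta>_nonneg X \<gamma>]) (auto simp: less_imp_le)
    also have "\<dots> = (\<Sum>j<k. 4 * C\<^sup>2 * (real (len \<gamma>))\<^sup>2 * q ^ j)"
    proof (rule sum.cong)
      fix j
      have "((2 ^ j) powr c)\<^sup>2 / mass (\<eta> j) * (4 * (\<eta> j)\<^sup>2 * (real (len \<gamma>))\<^sup>2 * mass (\<eta> j))
          = 4 * (real (len \<gamma>))\<^sup>2 * (((2 ^ j) powr c)\<^sup>2 * (\<eta> j)\<^sup>2)"
        using mass[of j] by (simp add: field_simps)
      then show "((2 ^ j) powr c)\<^sup>2 / mass (\<eta> j) * (4 * (\<eta> j)\<^sup>2 * (real (len \<gamma>))\<^sup>2 * mass (\<eta> j))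
          = 4 * C\<^sup>2 * (real (len \<gamma>))\<^sup>2 * q ^ j"
        by (simp only: pow) simp
    qed simp
    also have "\<dots> = 4 * C\<^sup>2 * (real (len \<gamma>))\<^sup>2 * (\<Sum>j<k. q ^ j)" by (simp add: sum_distrib_left)
    also have "\<dots> \<le> 4 * C\<^sup>2 * (real (len \<gamma>))\<^sup>2 * (1 / (1 - q))"
    proof (rule mult_left_mono)
      have "(\<Sum>j<k. q ^ j) \<le> (\<Sum>j. q ^ j)"
        using \<open>0 \<le> q\<close> \<open>q < 1\<close> by (intro sum_le_suminf summable_geometric) auto
      then show "(\<Sum>j<k. q ^ j) \<le> 1 / (1 - q)" using \<open>0 \<le> q\<close> \<open>q < 1\<close> by (simp add: suminf_geometric)
    qed simp
    finally show ?thesis by (simp add: M_def mult_ac)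
  qed
  have in_ell2: "(\<lambda>i. F (\<tau> \<gamma> i) - F i) \<in> ell2" if "\<gamma> \<in> carrier G" for \<gamma>
    by (rule ell2_bounded(1)[OF bounded[OF that]])

  interpret P: permutation_coboundary G S \<tau> F
  proof
    show "\<tau> \<one> i = i" for i using J_G[of i] by (simp add: \<tau>_def ix_J)
    show "\<tau> (\<gamma> \<otimes> \<delta>) i = \<tau> \<delta> (\<tau> \<gamma> i)" if "\<gamma> \<in> carrier G" "\<delta> \<in> carrier G" for \<gamma> \<delta> i
    proof -
      have "\<tau> \<delta> (\<tau> \<gamma> i) = ix (fst (J (\<tau> \<gamma> i)), inv \<delta> \<otimes> snd (J (\<tau> \<gamma> i)))"
        by (simp only: \<tau>_def)
      also have "\<dots> = ix (fst (J i), inv \<delta> \<otimes> (inv \<gamma> \<otimes> snd (J i)))"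
        by (simp only: J_\<tau>[OF that(1)] fst_conv snd_conv)
      also have "\<dots> = \<tau> (\<gamma> \<otimes> \<delta>) i"
        using that J_G[of i] by (simp add: \<tau>_def inv_mult_group m_assoc)
      finally show ?thesis by (rule sym)
    qed
  qed (rule in_ell2)

  show ?thesis
  proof (rule P.compression_exponent_orbit_ge[where \<kappa> = "(1 / 2) powr c / 3" and C = "sqrt M"])
    fix \<gamma> assume \<gamma>: "\<gamma> \<in> carrier G"
    have "sqrt (\<Sum>i. (F (\<tau> \<gamma> i) - F i)\<^sup>2) \<le> sqrt (M * (real (len \<gamma>))\<^sup>2)"
      by (intro real_sqrt_le_mono ell2_bounded(2) bounded \<gamma>)
    then show "ell2_norm (\<lambda>i. F (\<tau> \<gamma> i) - F i) \<le> sqrt M * real (len \<gamma>)"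
      by (simp add: ell2_norm_def real_sqrt_mult)
    show "(1 / 2) powr c / 3 * real (len \<gamma>) powr c \<le> ell2_norm (\<lambda>i. F (\<tau> \<gamma> i) - F i)"
    proof (cases "len \<gamma> = 0")
      case True
      then show ?thesis using ell2_norm_nonneg[OF in_ell2[OF \<gamma>]] by simp
    next
      case False
      then obtain j where j: "2 ^ j \<le> len \<gamma>" "len \<gamma> < 2 ^ (j + 1)"
        using ex_power_ivl1[of 2 "len \<gamma>"] by auto
      let ?A0 = "{x \<in> carrier G. 2 * len x < len \<gamma>}"
      have fin: "finite ?A0" by (rule finite_subset[OF _ finite_ball[of "len \<gamma>"]]) (auto simp: mem_ball)
      define I where "I = (\<lambda>x. ix (j, x)) ` ?A0"
      have J_I: "J (ix (j, x)) = (j, x)" if "x \<in> carrier G" for x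
        using that by (intro J_ix) (simp add: A_def)
      have inj: "inj_on (\<lambda>x. ix (j, x)) ?A0"
      proof (rule inj_onI)
        fix x y assume xy: "x \<in> ?A0" "y \<in> ?A0" and eq: "ix (j, x) = ix (j, y)"
        have "(j, x) = J (ix (j, x))" using xy(1) by (intro J_I[symmetric]) blast
        also have "\<dots> = (j, y)" unfolding eq using xy(2) by (intro J_I) blast
        finally show "x = y" by (rule Pair_inject)
      qed
      \<comment> \<open>9 instead of 8, to have a rational square root\<close>
      have "((2 ^ j) powr c)\<^sup>2 / 9 \<le> ((2 ^ j) powr c)\<^sup>2 / mass (\<eta> j) * (mass (\<eta> j) / 8)"
      proof -
        have "((2 ^ j) powr c)\<^sup>2 / mass (\<eta> j) * (mass (\<eta> j) / 8) = ((2 ^ j) powr c)\<^sup>2 / 8"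
          using mass[of j] by simp
        then show ?thesis by (simp add: divide_left_mono)
      qed
      also have "\<dots> \<le> ((2 ^ j) powr c)\<^sup>2 / mass (\<eta> j) *
          (\<Sum>x\<in>?A0. (weight (\<eta> j) (inv \<gamma> \<otimes> x) - weight (\<eta> j) x)\<^sup>2)"
        by (intro mult_left_mono weight_displacement_ge[OF tail \<gamma> j(1)]) (simp add: mass less_imp_le)
      also have "\<dots> = (\<Sum>x\<in>?A0. (\<Phi> j (inv \<gamma> \<otimes> x) - \<Phi> j x)\<^sup>2)"
        by (simp add: difference_sq sum_distrib_left)
      also have "\<dots> = (\<Sum>i\<in>I. (F (\<tau> \<gamma> i) - F i)\<^sup>2)"
      proof -
        have "(\<Sum>i\<in>I. (F (\<tau> \<gamma> i) - F i)\<^sup>2) = (\<Sum>x\<in>?A0. (F (\<tau> \<gamma> (ix (j, x))) - F (ix (j, x)))\<^sup>2)"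
          unfolding I_def by (rule sum.reindex[OF inj, unfolded o_def])
        also have "\<dots> = (\<Sum>x\<in>?A0. (\<Phi> j (inv \<gamma> \<otimes> x) - \<Phi> j x)\<^sup>2)"
          by (intro sum.cong refl) (simp only: difference[OF \<gamma>] J_I mem_Collect_eq fst_conv snd_conv)
        finally show ?thesis by (rule sym)
      qed
      also have "\<dots> \<le> (ell2_norm (\<lambda>i. F (\<tau> \<gamma> i) - F i))\<^sup>2"
        using fin by (intro ell2_sum_le in_ell2 \<gamma>) (simp add: I_def)
      finally have "((2 ^ j) powr c / 3)\<^sup>2 \<le> (ell2_norm (\<lambda>i. F (\<tau> \<gamma> i) - F i))\<^sup>2"
        by (simp add: power_divide)
      then have "(2 ^ j) powr c / 3 \<le> ell2_norm (\<lambda>i. F (\<tau> \<gamma> i) - F i)"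
        by (rule power2_le_imp_le) (rule ell2_norm_nonneg[OF in_ell2[OF \<gamma>]])
      moreover have "(1 / 2) powr c * real (len \<gamma>) powr c \<le> (2 ^ j) powr c"
      proof -
        have "real (len \<gamma>) \<le> real (2 ^ (j + 1))" using j(2) by (simp only: of_nat_le_iff less_imp_le)
        then have "1 / 2 * real (len \<gamma>) \<le> 2 ^ j" by simp
        then have "(1 / 2 * real (len \<gamma>)) powr c \<le> (2 ^ j) powr c"
          using assms by (intro powr_mono2) auto
        also have "(1 / 2 * real (len \<gamma>)) powr c = (1 / 2) powr c * real (len \<gamma>) powr c"
          by (rule powr_mult)
        finally show ?thesis .
      qed
      ultimately show ?thesis by simp
    qed
  qed (use assms \<nu>_pos in auto)
qed

lemma equivariant_compression_exponent_ge:
  "1 - \<nu> \<le> equivariant_compression_exponent TYPE('u) G S"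
proof (cases "\<nu> < 1")
  case True
  have "1 - \<nu> \<le> equivariant_compression_exponent TYPE('u) G S" if "0 < 1 - \<nu>"
    using that by (rule dense_le_bounded) (rule equivariant_compression_exponent_ge_of_less)
  then show ?thesis using True by simp
next
  case False
  have "0 \<le> equivariant_compression_exponent TYPE('u) G S"
    unfolding equivariant_compression_exponent_def
    by (rule sup_unit_nonneg) (use compression_exponent_in_unit in blast)
  then show ?thesis using False by simp
qed

end

section \<open>Speed, entropy and compression under stretched exponential growth\<close>

theorem theorem1p3:
  fixes G :: "('a, 'm) monoid_scheme" and S :: "'a set" and K L \<nu> :: real
  assumes "group G"
    and "symmetric_generating_set G S"
    and "K > 0" and "L > 0" and "0 < \<nu>" and "\<nu> \<le> 1"
    and "\<forall>n\<ge>1. real (card (word_ball G S n)) \<le> L * exp (K * real n powr \<nu>)"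
  shows
    "((\<exists>K'>0. \<exists>K''>0. \<exists>L''>0. \<forall>n\<ge>1.
          speed G S n \<le> K' * real n powr (1 / (2 - \<nu>)) \<and>
          walk_entropy G S n \<le> L'' + K'' * real n powr (\<nu> / (2 - \<nu>))) \<and>
      speed_exponent G S \<le> 1 / (2 - \<nu>)) \<and>
     equivariant_compression_exponent TYPE('u) G S \<ge> 1 - \<nu> \<and>
     (\<forall>K' L' h :: real. K' > 0 \<longrightarrow> L' > 0 \<longrightarrow>
        (\<forall>n\<ge>1. walk_entropy G S n \<ge> K' + L' * real n powr h) \<longrightarrow>
        speed_exponent G S * \<nu> \<ge> h \<and>
        2 * h * equivariant_compression_exponent TYPE('u) G S \<le> \<nu>)"
proof -
  interpret stretched_growth G S K L \<nu>
    using assms by (intro stretched_growth.intro marked_group.intro marked_group_axioms.intro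
        stretched_growth_axioms.intro) auto
  obtain K' where K': "K' > 0" "\<And>n. n \<ge> 1 \<Longrightarrow> speed G S n \<le> K' * real n powr (1 / (2 - \<nu>))"
    using speed_upper_bound by blast
  obtain K'' L'' where K'': "K'' > 0" "L'' > 0"
    "\<And>n. n \<ge> 1 \<Longrightarrow> walk_entropy G S n \<le> L'' + K'' * real n powr (\<nu> / (2 - \<nu>))"
    using entropy_upper_bound by blast
  show ?thesis
  proof (intro conjI allI impI)
    show "\<exists>K'>0. \<exists>K''>0. \<exists>L''>0. \<forall>n\<ge>1.
        speed G S n \<le> K' * real n powr (1 / (2 - \<nu>)) \<and>
        walk_entropy G S n \<le> L'' + K'' * real n powr (\<nu> / (2 - \<nu>))"
      by (rule exI[of _ K'], rule conjI[OF K'(1)], rule exI[of _ K''], rule conjI[OF K''(1)],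
          rule exI[of _ L''], rule conjI[OF K''(2)]) (simp add: K'(2) K''(3))
  qed (rule speed_exponent_le equivariant_compression_exponent_ge speed_exponent_ge
      entropy_exponent_equivariant_compression_le; assumption)+
qed

end
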